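(* There exists a $b$-contact form on the $b$-manifold $(\mathbb{S}^3,\mathbb{S}^2)$ such that the flow of the associated Reeb $b$-vector field has no singular periodic orbits and no periodic orbits outside of the critical set $\mathbb{S}^2$.
   Context: A $b$-manifold $(M,Z)$ is a smooth manifold $M$ with an embedded smooth hypersurface $Z$, called the critical set. Here $\mathbb{S}^3=\{x_1^2+y_1^2+x_2^2+y_2^2=1\}\subset\mathbb{R}^4$ and $\mathbb{S}^2=\mathbb{S}^3\cap\{x_1=0\}$ is the equatorial $2$-sphere, which is the critical set. The $b$-tangent bundle ${}^bTM$ is the vector bundle whose sections are the vector fields on $M$ tangent to $Z$ (the $b$-vector fields); ${}^bT^*M$ is its dual, and a $b$-form of degree $k$ is a section of $\bigwedge^k({}^bT^*M)$. Near $Z$, given a defining function $z$ of $Z$, a $b$-form of degree $k$ can be written $\omega=\alpha\wedge\frac{dz}{z}+\beta$ with $\alpha$, $\beta$ smooth forms of degrees $k-1$ and $k$, and $d\omega:=d\alpha\wedge\frac{dz}{z}+d\beta$. On a $b$-manifold of dimension $2n+1$, a $b$-contact form is a $b$-form $\alpha$ of degree one such that $\alpha\wedge(d\alpha)^n$ is nowhere vanishing as a section of $\bigwedge^{2n+1}({}^bT^*M)$. Its Reeb $b$-vector field is the unique $b$-vector field $R_\alpha$ with $\iota_{R_\alpha}d\alpha=0$ and $\iota_{R_\alpha}\alpha=1$. A singular periodic orbit is an integral curve $\gamma:\mathbb{R}\to M\setminus Z$ of $R_\alpha$ such that $\lim_{t\to+\infty}\gamma(t)=p_+\in Z$ and $\lim_{t\to-\infty}\gamma(t)=p_-\in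 Z$ both exist as single points. *)

theory Defs
  imports "HOL-Analysis.Analysis"
begin

text \<open>
  Manifolds are embedded submanifolds \<open>M\<close> of a Euclidean space \<open>'a\<close>. Functions, vector fields and
  forms on \<open>M\<close> are total functions of which only the values at points of \<open>M\<close> matter.
\<close>

subsection \<open>Smooth functions\<close>

text \<open>
  In finite dimension, existence and continuity of all iterated directional derivatives of order
  at most \<open>k\<close>, as demanded here, is the usual notion of a \<open>C\<close>-\<open>k\<close> map on an open set.
\<close>

primrec Ck_on :: "nat \<Rightarrow> 'a::euclidean_space set \<Rightarrow> ('a \<Rightarrow> 'b::real_normed_vector) \<Rightarrow> bool" where
  "Ck_on 0 U f \<longleftrightarrow> continuous_on U f"
| "Ck_on (Suc k) U f \<longleftrightarrow> (\<forall>x\<in>U. f differentiable (at x)) \<and>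
     (\<forall>v. Ck_on k U (\<lambda>x. frechet_derivative f (at x) v))"

definition smooth :: "'a::euclidean_space set \<Rightarrow> ('a \<Rightarrow> 'b::real_normed_vector) \<Rightarrow> bool" where
  "smooth M f \<longleftrightarrow> (\<forall>p\<in>M. \<exists>U g. open U \<and> p \<in> U \<and> (\<forall>k. Ck_on k U g) \<and> (\<forall>q\<in>M \<inter> U. g q = f q))"

text \<open>
  Velocities of curves in \<open>M\<close>. The curve need not be continuous away from time \<open>0\<close>, so that asking it
  to stay in \<open>M\<close> for all times, instead of for small times, is no restriction.
\<close>

definition tangent_space :: "'a::euclidean_space set \<Rightarrow> 'a \<Rightarrow> 'a set" where
  "tangent_space M p =
     {v. \<exists>\<gamma>. \<gamma> 0 = p \<and> (\<forall>t. \<gamma> t \<in> M) \<and> (\<gamma> has_vector_derivative v) (at (0::real))}"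

text \<open>
  The differential of \<open>f\<close> on the tangent vector \<open>v\<close> at \<open>p\<close>. A derivative within \<open>M\<close> is not unique as a
  linear map on \<open>'a\<close>, but any two of them agree on \<open>tangent_space M p\<close>, the only place where it is used.
\<close>

definition diff_on :: "'a::euclidean_space set \<Rightarrow> ('a \<Rightarrow> 'b::real_normed_vector) \<Rightarrow> 'a \<Rightarrow> 'a \<Rightarrow> 'b" where
  "diff_on M f p v = frechet_derivative f (at p within M) v"

definition lie_bracket ::
    "'a::euclidean_space set \<Rightarrow> ('a \<Rightarrow> 'a) \<Rightarrow> ('a \<Rightarrow> 'a) \<Rightarrow> 'a \<Rightarrow> 'a" where
  "lie_bracket M X Y = (\<lambda>p. diff_on M Y p (X p) - diff_on M X p (Y p))"

subsection \<open>\<open>b\<close>-vector fields and \<open>b\<close>-forms\<close>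

definition b_vector_fields :: "'a::euclidean_space set \<Rightarrow> 'a set \<Rightarrow> ('a \<Rightarrow> 'a) set" where
  "b_vector_fields M Z = {X. smooth M X \<and> (\<forall>p\<in>M. X p \<in> tangent_space M p) \<and>
     (\<forall>p\<in>Z. X p \<in> tangent_space Z p)}"

text \<open>
  The \<open>b\<close>-tangent bundle is known through its sections, the \<open>b\<close>-vector fields: its fibre at \<open>p\<close> is the
  space of \<open>b\<close>-vector fields modulo the combinations \<open>\<Sum>i. f i X i\<close> with all \<open>f i p = 0\<close>. An element
  of the dual fibre at \<open>p\<close> is thus a functional \<open>\<xi>\<close> on \<open>b\<close>-vector fields with
  \<open>\<xi> (f X + Y) = f p * \<xi> X + \<xi> Y\<close>. A form of degree one is written \<open>\<alpha> p X\<close>, and forms of degrees two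
  and three \<open>\<eta> p X Y\<close> and \<open>\<mu> p X Y W\<close>. Note that \<open>\<alpha> p X\<close> is not a function of the vector \<open>X p\<close> when
  \<open>p \<in> Z\<close>. For \<open>Z = {}\<close> the definition gives the ordinary smooth 1-forms on \<open>M\<close>.
\<close>

definition b_form1 ::
    "'a::euclidean_space set \<Rightarrow> 'a set \<Rightarrow> ('a \<Rightarrow> ('a \<Rightarrow> 'a) \<Rightarrow> real) \<Rightarrow> bool" where
  "b_form1 M Z \<alpha> \<longleftrightarrow>
     (\<forall>X\<in>b_vector_fields M Z. smooth M (\<lambda>p. \<alpha> p X)) \<and>
     (\<forall>f. smooth M f \<longrightarrow> (\<forall>X\<in>b_vector_fields M Z. \<forall>Y\<in>b_vector_fields M Z. \<forall>p\<in>M.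
        \<alpha> p (\<lambda>q. f q *\<^sub>R X q + Y q) = f p * \<alpha> p X + \<alpha> p Y))"

definition defining_function :: "'a::euclidean_space set \<Rightarrow> 'a set \<Rightarrow> ('a \<Rightarrow> real) \<Rightarrow> bool" where
  "defining_function M Z z \<longleftrightarrow> smooth M z \<and> Z = {p\<in>M. z p = 0} \<and>
     (\<forall>p\<in>Z. \<exists>v\<in>tangent_space M p. diff_on M z p v \<noteq> 0)"

text \<open>
  The \<open>b\<close>-form \<open>dz/z\<close>. For a \<open>b\<close>-vector field \<open>X\<close> the function \<open>dz X\<close> vanishes on \<open>Z\<close>, hence \<open>dz X / z\<close>
  extends smoothly over \<open>Z\<close>, and the value at points of \<open>Z\<close> is that of the extension.
\<close>

definition dlog ::
    "'a::euclidean_space set \<Rightarrow> 'a set \<Rightarrow> ('a \<Rightarrow> real) \<Rightarrow> 'a \<Rightarrow> ('a \<Rightarrow> 'a) \<Rightarrow> real" where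
  "dlog M Z z p X =
     (if p \<in> Z then Lim (at p within M - Z) (\<lambda>q. diff_on M z q (X q) / z q)
      else diff_on M z p (X p) / z p)"

subsection \<open>Exterior calculus\<close>

text \<open>Ordinary exterior derivative of a smooth 1-form.\<close>

definition ext_deriv ::
    "'a::euclidean_space set \<Rightarrow> ('a \<Rightarrow> ('a \<Rightarrow> 'a) \<Rightarrow> real) \<Rightarrow> 'a \<Rightarrow> ('a \<Rightarrow> 'a) \<Rightarrow> ('a \<Rightarrow> 'a) \<Rightarrow> real" where
  "ext_deriv M \<beta> p X Y =
     diff_on M (\<lambda>q. \<beta> q Y) p (X p) - diff_on M (\<lambda>q. \<beta> q X) p (Y p) - \<beta> p (lie_bracket M X Y)"

definition wedge11 ::
    "('a \<Rightarrow> ('a \<Rightarrow> 'a) \<Rightarrow> real) \<Rightarrow> ('a \<Rightarrow> ('a \<Rightarrow> 'a) \<Rightarrow> real) \<Rightarrow> 'a \<Rightarrow> ('a \<Rightarrow> 'a) \<Rightarrow> ('a \<Rightarrow> 'a) \<Rightarrow> real" where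
  "wedge11 \<alpha> \<beta> p X Y = \<alpha> p X * \<beta> p Y - \<alpha> p Y * \<beta> p X"

definition wedge12 ::
    "('a \<Rightarrow> ('a \<Rightarrow> 'a) \<Rightarrow> real) \<Rightarrow> ('a \<Rightarrow> ('a \<Rightarrow> 'a) \<Rightarrow> ('a \<Rightarrow> 'a) \<Rightarrow> real) \<Rightarrow>
     'a \<Rightarrow> ('a \<Rightarrow> 'a) \<Rightarrow> ('a \<Rightarrow> 'a) \<Rightarrow> ('a \<Rightarrow> 'a) \<Rightarrow> real" where
  "wedge12 \<alpha> \<eta> p X Y W = \<alpha> p X * \<eta> p Y W - \<alpha> p Y * \<eta> p X W + \<alpha> p W * \<eta> p X Y"

text \<open>
  \<open>\<eta> = d\<alpha>\<close> for a \<open>b\<close>-form \<open>\<alpha>\<close> of degree one: locally \<open>\<alpha> = f dz/z + \<beta>\<close> and \<open>\<eta> = df \<and> dz/z + d\<beta>\<close>, with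
  \<open>f\<close> a smooth function, \<open>\<beta>\<close> a smooth 1-form and \<open>z\<close> a defining function of \<open>Z\<close>. Near a point outside
  \<open>Z\<close> this includes \<open>\<eta> = d\<alpha>\<close> in the ordinary sense (\<open>z = 1\<close>, \<open>\<beta> = \<alpha>\<close>).
\<close>

definition has_b_ext_deriv ::
    "'a::euclidean_space set \<Rightarrow> 'a set \<Rightarrow> ('a \<Rightarrow> ('a \<Rightarrow> 'a) \<Rightarrow> real) \<Rightarrow>
     ('a \<Rightarrow> ('a \<Rightarrow> 'a) \<Rightarrow> ('a \<Rightarrow> 'a) \<Rightarrow> real) \<Rightarrow> bool" where
  "has_b_ext_deriv M Z \<alpha> \<eta> \<longleftrightarrow>
     (\<forall>p\<in>M. \<exists>U z f \<beta>. open U \<and> p \<in> U \<and>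
        defining_function (M \<inter> U) (Z \<inter> U) z \<and> smooth (M \<inter> U) f \<and> b_form1 (M \<inter> U) {} \<beta> \<and>
        (\<forall>q\<in>M \<inter> U.
          (\<forall>X\<in>b_vector_fields M Z.
             \<alpha> q X = f q * dlog (M \<inter> U) (Z \<inter> U) z q X + \<beta> q X) \<and>
          (\<forall>X\<in>b_vector_fields M Z. \<forall>Y\<in>b_vector_fields M Z.
             \<eta> q X Y = wedge11 (\<lambda>x V. diff_on (M \<inter> U) f x (V x)) (dlog (M \<inter> U) (Z \<inter> U) z) q X Y
                         + ext_deriv (M \<inter> U) \<beta> q X Y)))"

subsection \<open>\<open>b\<close>-contact forms in dimension three and their Reeb fields\<close>

definition b_contact_form3 ::
    "'a::euclidean_space set \<Rightarrow> 'a set \<Rightarrow> ('a \<Rightarrow> ('a \<Rightarrow> 'a) \<Rightarrow> real) \<Rightarrow> bool" where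
  "b_contact_form3 M Z \<alpha> \<longleftrightarrow> b_form1 M Z \<alpha> \<and>
     (\<exists>d\<alpha>. has_b_ext_deriv M Z \<alpha> d\<alpha> \<and>
        (\<forall>p\<in>M. \<exists>X\<in>b_vector_fields M Z. \<exists>Y\<in>b_vector_fields M Z. \<exists>W\<in>b_vector_fields M Z.
           wedge12 \<alpha> d\<alpha> p X Y W \<noteq> 0))"

definition reeb_b_vector_field ::
    "'a::euclidean_space set \<Rightarrow> 'a set \<Rightarrow> ('a \<Rightarrow> ('a \<Rightarrow> 'a) \<Rightarrow> real) \<Rightarrow> ('a \<Rightarrow> 'a) \<Rightarrow> bool" where
  "reeb_b_vector_field M Z \<alpha> R \<longleftrightarrow> R \<in> b_vector_fields M Z \<and>
     (\<exists>d\<alpha>. has_b_ext_deriv M Z \<alpha> d\<alpha> \<and> (\<forall>p\<in>M. \<forall>Y\<in>b_vector_fields M Z. d\<alpha> p R Y = 0)) \<and>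
     (\<forall>p\<in>M. \<alpha> p R = 1)"

subsection \<open>Orbits\<close>

definition integral_curve :: "('a::euclidean_space \<Rightarrow> 'a) \<Rightarrow> (real \<Rightarrow> 'a) \<Rightarrow> bool" where
  "integral_curve R \<gamma> \<longleftrightarrow> (\<forall>t. (\<gamma> has_vector_derivative R (\<gamma> t)) (at t))"

definition singular_periodic_orbit ::
    "'a::euclidean_space set \<Rightarrow> 'a set \<Rightarrow> ('a \<Rightarrow> 'a) \<Rightarrow> (real \<Rightarrow> 'a) \<Rightarrow> bool" where
  "singular_periodic_orbit M Z R \<gamma> \<longleftrightarrow> integral_curve R \<gamma> \<and> range \<gamma> \<subseteq> M - Z \<and>
     (\<exists>p\<in>Z. (\<gamma> \<longlongrightarrow> p) at_top) \<and> (\<exists>p\<in>Z. (\<gamma> \<longlongrightarrow> p) at_bot)"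

text \<open>
  A Reeb field has no zeros outside \<open>Z\<close>, so constant curves need not be excluded here.
\<close>

definition periodic_orbit_outside ::
    "'a::euclidean_space set \<Rightarrow> 'a set \<Rightarrow> ('a \<Rightarrow> 'a) \<Rightarrow> (real \<Rightarrow> 'a) \<Rightarrow> bool" where
  "periodic_orbit_outside M Z R \<gamma> \<longleftrightarrow> integral_curve R \<gamma> \<and> range \<gamma> \<subseteq> M - Z \<and>
     (\<exists>T>0. \<forall>t. \<gamma> (t + T) = \<gamma> t)"

subsection \<open>The sphere and its equator\<close>

text \<open>The components \<open>1, 2, 3, 4\<close> of a vector are the coordinates \<open>x1, y1, x2, y2\<close>.\<close>

definition S3 :: "(real ^ 4) set" where
  "S3 = sphere 0 1"

definition S2 :: "(real ^ 4) set" where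
  "S2 = S3 \<inter> {p. p $ 1 = 0}"

lemma Ck_on_bounded_linear: "bounded_linear f \<Longrightarrow> Ck_on k U f"
proof -
  assume f: "bounded_linear f"
  have const: "Ck_on k U (\<lambda>_. c)" for k and c :: 'b
    by (induction k arbitrary: c) (simp_all add: frechet_derivative_const)
  have fd: "frechet_derivative f (at x) = f" for x
    using bounded_linear_imp_has_derivative[OF f] frechet_derivative_at by metis
  show ?thesis
    using f by (cases k) (auto simp: fd const linear_continuous_on bounded_linear_imp_differentiable)
qed

text \<open>In particular \<open>S2\<close> is an embedded hypersurface of \<open>S3\<close>.\<close>

lemma defining_function_S3: "defining_function S3 S2 (\<lambda>p. p $ 1)"
  unfolding defining_function_def
proof (intro conjI ballI)
  have bl: "bounded_linear (\<lambda>p::real^4. p $ 1)"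
    by (rule bounded_linear_vec_nth)
  show "smooth S3 (\<lambda>p. p $ 1)"
    unfolding smooth_def using Ck_on_bounded_linear[OF bl] open_UNIV by blast
  show "S2 = {p \<in> S3. p $ 1 = 0}"
    by (auto simp: S2_def)
  fix p assume p: "p \<in> S2"
  define e :: "real^4" where "e = axis 1 1"
  define \<gamma> where "\<gamma> t = cos t *\<^sub>R p + sin t *\<^sub>R e" for t
  have pe: "p \<bullet> p = 1" "p \<bullet> e = 0" "e \<bullet> e = 1" "e \<bullet> p = 0" "e $ 1 = 1" "p $ 1 = 0"
    using p by (auto simp: S2_def S3_def e_def inner_axis inner_axis' norm_eq_1)
  have "\<gamma> t \<bullet> \<gamma> t = 1" for t
    by (simp add: \<gamma>_def pe inner_add_left inner_add_right flip: power2_eq_square)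
  then have mem: "\<gamma> t \<in> S3" for t
    by (simp add: S3_def norm_eq_1)
  have der: "(\<gamma> has_vector_derivative e) (at 0)"
    unfolding \<gamma>_def by (auto intro!: derivative_eq_intros)
  have g0: "\<gamma> 0 = p"
    by (simp add: \<gamma>_def)
  have tan: "e \<in> tangent_space S3 p"
    unfolding tangent_space_def using mem der g0 by blast
  let ?D = "frechet_derivative (\<lambda>q::real^4. q $ 1) (at p within S3)"
  have "((\<lambda>q::real^4. q $ 1) has_derivative ?D) (at p within S3)"
    using bounded_linear_imp_differentiable[OF bl] frechet_derivative_works by blast
  then have "((\<lambda>q::real^4. q $ 1) has_derivative ?D) (at (\<gamma> 0) within range \<gamma>)"
    unfolding g0 by (rule has_derivative_subset) (use mem in auto)
  from vector_derivative_diff_chain_within[OF der this]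
  have 1: "(((\<lambda>q. q $ 1) \<circ> \<gamma>) has_vector_derivative ?D e) (at 0)"
    by simp
  have "(((\<lambda>q. q $ 1) \<circ> \<gamma>) has_vector_derivative 1) (at 0)"
    unfolding o_def \<gamma>_def by (auto simp: pe has_real_derivative_iff_has_vector_derivative[symmetric] intro!: derivative_eq_intros)
  then have "?D e = 1"
    using 1 vector_derivative_unique_at by blast
  then show "\<exists>v\<in>tangent_space S3 p. diff_on S3 (\<lambda>p. p $ 1) p v \<noteq> 0"
    unfolding diff_on_def by (intro bexI[OF _ tan]) simp
qed

end

theory Submission
  imports Defs
begin

text \<open>
  Let \<open>X = x2 - c x1\<^sup>2\<close> with \<open>c = 1/10\<close>, and let \<open>\<alpha>\<close> be the restriction of
  \<open>- y1 dx1/x1 + dy1/4 + X dy2 - y2 dX\<close> to the sphere. Then \<open>d\<alpha> = dx1/x1 \<and> dy1 + 2 dX \<and> dy2\<close>, and up to a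
  positive factor the Reeb field is the Hamiltonian field of \<open>\<bar>p\<bar>\<^sup>2/2\<close>,

    \<open>x1' = - x1 y1\<close>, \<open>y1' = x1\<^sup>2 (1 + x2/5)\<close>, \<open>X' = - y2/2\<close>, \<open>y2' = x2/2 = (X + c x1\<^sup>2)/2\<close>.

  Outside \<open>S2\<close> the function \<open>y1\<close> increases strictly, so there are no periodic orbits
  (\<open>y_strict_mono\<close>).

  For \<open>c = 0\<close> this would be the standard example, in which the circle \<open>x2 = y2 = 0\<close> consists of the poles
  \<open>y1 = 1\<close> and \<open>y1 = -1\<close> of \<open>S2\<close> and of two singular periodic orbits that join them. The term \<open>c x1\<^sup>2\<close>
  breaks these connections. Indeed, both ends of a singular periodic orbit are zeros of the field,
  so \<open>X\<close> and \<open>y2\<close> tend to \<open>0\<close> in both directions. The vector \<open>(X, y2)\<close> rotates and its length changes only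
  through the force \<open>c x1\<^sup>2/2\<close>, that is, at most \<open>1/16\<close> times as fast as \<open>y1\<close>. Therefore its length is at
  most \<open>(1 - \<bar>y1\<bar>)/16 \<le> (1 - y1\<^sup>2)/16\<close> (\<open>radius_bound\<close>), which is less than \<open>c x1\<^sup>2\<close> on the sphere. So
  \<open>x2 = X + c x1\<^sup>2\<close> is positive all along the orbit (\<open>third_positive\<close>) and \<open>y2\<close> increases strictly. It
  cannot tend to \<open>0\<close> in both directions, a contradiction (\<open>not_singular\<close>).

  The remaining work is to show that \<open>\<alpha>\<close> is a \<open>b\<close>-contact form with this Reeb field. Its smoothness rests
  on Hadamard's lemma (\<open>hadamard_division\<close>): for a \<open>b\<close>-vector field \<open>V\<close> the quotient \<open>dx1 (V) / x1\<close> is smooth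
  across \<open>S2\<close>. Once this is known, \<open>d\<alpha>\<close> is computed componentwise (\<open>dalpha_formula\<close>).
\<close>

section \<open>Calculus of smooth maps on open sets\<close>

text \<open>
  The iterated directional derivatives in the definition of \<open>Ck_on\<close> are taken in the ambient
  space, so a function may be replaced by an equal one only on an open set.
\<close>

lemma Ck_on_cong:
  assumes "open U" "\<And>x. x \<in> U \<Longrightarrow> f x = g x"
  shows "Ck_on k U f \<longleftrightarrow> Ck_on k U g"
proof -
  have "Ck_on k U g" if "Ck_on k U f" "\<And>x. x \<in> U \<Longrightarrow> f x = g x" for f g
    using that
  proof (induction k arbitrary: f g)
    case 0
    then show ?case
      using continuous_on_cong[of U U f g] by simp
  next
    case (Suc k)
    have fd: "frechet_derivative f (at x) = frechet_derivative g (at x)" if "x \<in> U" for x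
      using Suc.prems that \<open>open U\<close> by (intro frechet_derivative_transform_within_open) auto
    have "g differentiable (at x)" if "x \<in> U" for x
      using Suc.prems that \<open>open U\<close>
      unfolding differentiable_def Ck_on.simps
      by (meson has_derivative_transform_within_open)
    moreover have "Ck_on k U (\<lambda>x. frechet_derivative g (at x) v)" for v
    proof (rule Suc.IH)
      show "Ck_on k U (\<lambda>x. frechet_derivative f (at x) v)"
        using Suc.prems(1) by simp
    qed (simp only: fd)
    ultimately show ?case
      by simp
  qed
  from this[of f g] this[of g f] show ?thesis
    using assms(2) by auto
qed

text \<open>
  The closure properties are proved by induction on the order: a formula for the derivative on an open
  set reduces order \<open>Suc k\<close> to order \<open>k\<close>.
\<close>

lemma Ck_on_SucI:
  assumes "open U" and D: "\<And>x. x \<in> U \<Longrightarrow> (f has_derivative f' x) (at x)"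
    and "\<And>v. Ck_on k U (\<lambda>x. f' x v)"
  shows "Ck_on (Suc k) U f"
proof -
  have fd: "frechet_derivative f (at x) = f' x" if "x \<in> U" for x
    using frechet_derivative_at[OF D[OF that]] by simp
  have "Ck_on k U (\<lambda>x. frechet_derivative f (at x) v)" for v
    using Ck_on_cong[OF \<open>open U\<close>, of "\<lambda>x. frechet_derivative f (at x) v" "\<lambda>x. f' x v" k]
      fd assms(3) by simp
  then show ?thesis
    using D by (auto simp: differentiable_def)
qed

lemma Ck_on_SucD:
  assumes "Ck_on (Suc k) U f"
  shows "x \<in> U \<Longrightarrow> (f has_derivative frechet_derivative f (at x)) (at x)"
    and "Ck_on k U (\<lambda>x. frechet_derivative f (at x) v)"
  using assms frechet_derivative_works by auto

lemma Ck_on_Suc_imp: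
  "Ck_on (Suc k) U f \<Longrightarrow> Ck_on k U f"
proof (induction k arbitrary: f)
  case 0
  then show ?case
    by (auto intro!: continuous_at_imp_continuous_on differentiable_imp_continuous_within)
next
  case (Suc k)
  from Suc.prems have "\<forall>x\<in>U. f differentiable at x"
    and "\<And>v. Ck_on (Suc k) U (\<lambda>x. frechet_derivative f (at x) v)"
    by auto
  with Suc.IH show ?case
    by simp
qed

lemma Ck_on_imp_continuous_on: "Ck_on k U f \<Longrightarrow> continuous_on U f"
  by (induction k) (use Ck_on_Suc_imp in auto)

lemma Ck_on_subset: "Ck_on k U f \<Longrightarrow> V \<subseteq> U \<Longrightarrow> Ck_on k V f"
  by (induction k arbitrary: f) (auto intro: continuous_on_subset)

lemma Ck_on_const: "Ck_on k U (\<lambda>_. c)"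
  by (induction k arbitrary: c) (simp_all add: frechet_derivative_const)

lemma Ck_on_add:
  assumes "open U" "Ck_on k U f" "Ck_on k U g"
  shows "Ck_on k U (\<lambda>x. f x + g x)"
  using assms(2,3)
proof (induction k arbitrary: f g)
  case 0
  then show ?case by (simp add: continuous_on_add)
next
  case (Suc k)
  show ?case
    by (rule Ck_on_SucI[OF \<open>open U\<close> has_derivative_add[OF Ck_on_SucD(1)[OF Suc.prems(1)] Ck_on_SucD(1)[OF Suc.prems(2)]]])
      (use Suc in auto)
qed

lemma Ck_on_sum:
  assumes "open U" "\<And>i. i \<in> I \<Longrightarrow> Ck_on k U (f i)"
  shows "Ck_on k U (\<lambda>x. \<Sum>i\<in>I. f i x)"
  using assms(2)
  by (induction I rule: infinite_finite_induct) (auto simp: Ck_on_const intro: Ck_on_add[OF \<open>open U\<close>])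

lemma Ck_on_bilinear:
  assumes "bounded_bilinear bb" "open U" "Ck_on k U f" "Ck_on k U g"
  shows "Ck_on k U (\<lambda>x. bb (f x) (g x))"
  using assms(3,4)
proof (induction k arbitrary: f g)
  case 0
  then show ?case
    using bounded_bilinear.continuous_on[OF assms(1)] by auto
next
  case (Suc k)
  note D = bounded_bilinear.FDERIV[OF assms(1) Ck_on_SucD(1)[OF Suc.prems(1)] Ck_on_SucD(1)[OF Suc.prems(2)]]
  show ?case
    by (rule Ck_on_SucI[OF \<open>open U\<close> D])
      (use Suc Ck_on_Suc_imp[OF Suc.prems(1)] Ck_on_Suc_imp[OF Suc.prems(2)] in \<open>auto intro!: Ck_on_add[OF \<open>open U\<close>]\<close>)
qed

text \<open>
  The chain rule \<open>D (f \<circ> g) x v = D f (g x) (D g x v)\<close> evaluates \<open>D f\<close> in a direction that varies with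
  \<open>x\<close>, while \<open>Ck_on\<close> only speaks of fixed directions. Expanding \<open>D g x v\<close> in the basis makes the
  directions fixed.
\<close>

lemma Ck_on_compose:
  fixes f :: "'c::euclidean_space \<Rightarrow> 'b::real_normed_vector" and g :: "'a::euclidean_space \<Rightarrow> 'c"
  assumes "open U" "Ck_on k V f" "Ck_on k U g" "g ` U \<subseteq> V"
  shows "Ck_on k U (\<lambda>x. f (g x))"
  using assms(2,3)
proof (induction k arbitrary: f)
  case 0
  then show ?case
    using continuous_on_compose2[of V f U g] assms(4) by auto
next
  case (Suc k)
  let ?Df = "\<lambda>y. frechet_derivative f (at y)" and ?Dg = "\<lambda>x. frechet_derivative g (at x)"
  have D: "((\<lambda>x. f (g x)) has_derivative (\<lambda>v. \<Sum>b\<in>Basis. (?Dg x v \<bullet> b) *\<^sub>R ?Df (g x) b)) (at x)"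
    if "x \<in> U" for x
  proof -
    have Df: "(f has_derivative ?Df (g x)) (at (g x))"
      using Ck_on_SucD(1)[OF Suc.prems(1)] that assms(4) by auto
    have "?Df (g x) w = (\<Sum>b\<in>Basis. (w \<bullet> b) *\<^sub>R ?Df (g x) b)" for w
      using linear_sum[OF has_derivative_linear[OF Df], of "\<lambda>b. (w \<bullet> b) *\<^sub>R b" Basis]
        linear_scale[OF has_derivative_linear[OF Df]]
      by (simp add: euclidean_representation)
    then have "(\<lambda>v. ?Df (g x) (?Dg x v)) = (\<lambda>v. \<Sum>b\<in>Basis. (?Dg x v \<bullet> b) *\<^sub>R ?Df (g x) b)"
      by (intro ext)
    with has_derivative_compose[OF Ck_on_SucD(1)[OF Suc.prems(2) that] Df]
    show ?thesis
      by argo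
  qed
  have "Ck_on k U (\<lambda>x. (?Dg x v \<bullet> b) *\<^sub>R ?Df (g x) b)" for v b
  proof (rule Ck_on_bilinear[OF bounded_bilinear_scaleR \<open>open U\<close>])
    show "Ck_on k U (\<lambda>x. ?Dg x v \<bullet> b)"
      by (rule Ck_on_bilinear[OF bounded_bilinear_inner \<open>open U\<close> Ck_on_SucD(2)[OF Suc.prems(2)] Ck_on_const])
    show "Ck_on k U (\<lambda>x. ?Df (g x) b)"
      by (rule Suc.IH[OF Ck_on_SucD(2)[OF Suc.prems(1)] Ck_on_Suc_imp[OF Suc.prems(2)]])
  qed
  then show ?case
    by (intro Ck_on_SucI[OF \<open>open U\<close> D] Ck_on_sum[OF \<open>open U\<close>])
qed

lemma Ck_on_inverse:
  fixes f :: "'a::euclidean_space \<Rightarrow> real"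
  assumes "open U" "Ck_on k U f" "\<And>x. x \<in> U \<Longrightarrow> f x \<noteq> 0"
  shows "Ck_on k U (\<lambda>x. inverse (f x))"
  using assms(2)
proof (induction k)
  case 0
  then show ?case
    using assms(3) by (auto intro: continuous_on_inverse)
next
  case (Suc k)
  note M = Ck_on_bilinear[OF bounded_bilinear_mult \<open>open U\<close>]
  note I = Suc.IH[OF Ck_on_Suc_imp[OF Suc.prems]]
  have "Ck_on k U (\<lambda>x. - 1 * (inverse (f x) * frechet_derivative f (at x) v * inverse (f x)))" for v
    by (intro M Ck_on_const I Ck_on_SucD(2)[OF Suc.prems])
  then show ?case
    by (intro Ck_on_SucI[OF \<open>open U\<close> Deriv.has_derivative_inverse[OF assms(3) Ck_on_SucD(1)[OF Suc.prems]]]) auto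
qed

lemma Ck_on_norm:
  assumes "open U" "0 \<notin> U"
  shows "Ck_on k U norm"
proof (induction k)
  case 0
  show ?case by (simp add: continuous_on_norm_id)
next
  case (Suc k)
  have nz: "x \<noteq> 0" if "x \<in> U" for x using that assms(2) by auto
  have D: "(norm has_derivative (\<lambda>v. (x \<bullet> v) * inverse (norm x))) (at x)" if "x \<in> U" for x
    using has_derivative_norm[OF nz[OF that]] by (simp add: sgn_div_norm inner_commute mult.commute divide_inverse)
  have "Ck_on k U (\<lambda>x. (x \<bullet> v) * inverse (norm x))" for v
    using nz by (intro Ck_on_bilinear[OF bounded_bilinear_mult \<open>open U\<close>] Ck_on_inverse[OF \<open>open U\<close> Suc]
       Ck_on_bounded_linear bounded_linear_inner_left) auto
  then show ?case
    by (intro Ck_on_SucI[OF \<open>open U\<close> D])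
qed

text \<open>
  The weight \<open>m\<close> makes the induction close: differentiating \<open>h (q + s *\<^sub>R L q)\<close> in the direction \<open>v\<close>
  gives the directional derivatives of \<open>h\<close> along \<open>v\<close> and along \<open>L v\<close>, the second one multiplied by
  \<open>s\<close>. Both integrals are again of the form treated here, with weights \<open>m s\<close> and \<open>m s * s\<close>.
\<close>

lemma Ck_on_integral_param:
  fixes h :: "'a::euclidean_space \<Rightarrow> real" and L :: "'a \<Rightarrow> 'a"
  assumes "open W" "convex W" "bounded_linear L"
    and W: "\<And>q s. q \<in> W \<Longrightarrow> s \<in> {0..1} \<Longrightarrow> q + s *\<^sub>R L q \<in> W"
    and "Ck_on k W h" "continuous_on {0..1} m"
  shows "Ck_on k W (\<lambda>q. integral {0..1} (\<lambda>s. m s * h (q + s *\<^sub>R L q)))"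
proof -
  have L: "continuous_on X (\<lambda>x. L (f x))" if "continuous_on X f" for X :: "'c::t2_space set" and f
    using continuous_on_compose2[OF linear_continuous_on[OF \<open>bounded_linear L\<close>, of UNIV] that]
    by simp
  have C: "continuous_on (W \<times> cbox 0 1) (\<lambda>(q, s). m s * g (q + s *\<^sub>R L q))"
    if "continuous_on W g" "continuous_on {0..1} m" for g m :: "_ \<Rightarrow> real"
    unfolding case_prod_beta
    by (intro continuous_intros continuous_on_compose2[OF that(1)] continuous_on_compose2[OF that(2)] L)
      (auto intro!: W)
  show ?thesis
    using assms(5,6)
  proof (induction k arbitrary: h m)
    case 0
    then show ?case
      using integral_continuous_on_param[OF C[of h m]] by (simp add: cbox_interval)
  next
    case (Suc k)
    let ?D = "\<lambda>q. frechet_derivative h (at q)" and ?P = "\<lambda>s q. q + s *\<^sub>R L q"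
    note D = Ck_on_SucD[OF Suc.prems(1)]
    define E where "E q s v = m s * ?D (?P s q) (v + s *\<^sub>R L v)" for q s v
    have hD: "((\<lambda>q. m s * h (?P s q)) has_derivative E q s) (at q)" if "q \<in> W" "s \<in> {0..1}" for q s
    proof -
      have "(?P s has_derivative (\<lambda>v. v + s *\<^sub>R L v)) (at q)"
        by (intro derivative_intros bounded_linear_imp_has_derivative[OF \<open>bounded_linear L\<close>])
      from has_derivative_mult_right[OF has_derivative_compose[OF this D(1)[OF W[OF that]]]]
      show ?thesis
        unfolding E_def by (simp add: o_def)
    qed
    have bl: "bounded_linear (E q s)" if "q \<in> W" "s \<in> {0..1}" for q s
      using hD[OF that] by (rule has_derivative_bounded_linear)
    have E: "E q s v = m s * ?D (?P s q) v + (m s * s) * ?D (?P s q) (L v)"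
      if "q \<in> W" "s \<in> {0..1}" for q s v
      using has_derivative_linear[OF D(1)[OF W[OF that]]]
      by (simp add: E_def linear_add linear_scale algebra_simps)
    have ms: "continuous_on {0..1} (\<lambda>s. m s * s)"
      by (intro continuous_intros Suc.prems)
    note cD = Ck_on_imp_continuous_on[OF D(2)]
    have cE: "continuous_on (W \<times> cbox 0 1) (\<lambda>(q, s). E q s v)" for v
    proof -
      have "continuous_on (W \<times> cbox 0 1) (\<lambda>x. (\<lambda>(q, s). m s * ?D (?P s q) v) x
          + (\<lambda>(q, s). (m s * s) * ?D (?P s q) (L v)) x)"
        by (intro continuous_on_add C cD ms Suc.prems)
      then show ?thesis
        by (rule continuous_on_eq) (auto simp: E)
    qed
    \<comment> \<open>The Leibniz rule wants the derivative to be continuous as an operator-valued function.\<close>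
    define B where "B q s = Blinfun (E q s)" for q s
    have B: "blinfun_apply (B q s) = E q s" if "q \<in> W" "s \<in> {0..1}" for q s
      unfolding B_def by (rule bounded_linear_Blinfun_apply[OF bl[OF that]])
    have cB: "continuous_on (W \<times> cbox 0 1) (\<lambda>(q, s). B q s)"
    proof (rule continuous_on_blinfun_componentwise)
      fix i :: 'a
      show "continuous_on (W \<times> cbox 0 1) (\<lambda>x. blinfun_apply (case x of (q, s) \<Rightarrow> B q s) i)"
        by (rule continuous_on_eq[OF cE[of i]]) (auto simp: B)
    qed
    have slice: "continuous_on {0..1} (\<lambda>s. g q s)"
      if "continuous_on (W \<times> cbox 0 1) (\<lambda>(q, s). g q s)" "q \<in> W" for q and g :: "_ \<Rightarrow> real \<Rightarrow> 'c::t2_space"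
      using continuous_on_compose2[OF that(1), of "{0..1}" "\<lambda>s. (q, s)"] that(2)
        continuous_on_Pair[OF continuous_on_const[of _ q] continuous_on_id[of "{0..1}"]]
      by auto
    have leibniz: "((\<lambda>q. integral (cbox 0 1) (\<lambda>s. m s * h (?P s q))) has_derivative
        integral (cbox 0 1) (B q)) (at q within W)" if "q \<in> W" for q
    proof (rule leibniz_rule[OF _ _ cB that \<open>convex W\<close>])
      show "((\<lambda>q. m s * h (?P s q)) has_derivative B q s) (at q within W)"
        if "q \<in> W" "s \<in> cbox 0 1" for q s
        using hD[of q s] B[of q s] that by (auto intro: has_derivative_at_withinI)
      show "(\<lambda>s. m s * h (?P s q)) integrable_on cbox 0 1" if "q \<in> W" for q
        using slice[OF C[OF Ck_on_imp_continuous_on[OF Suc.prems(1)] Suc.prems(2)] that]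
          integrable_continuous_real by auto
    qed
    have split: "integral (cbox 0 1) (B q) v =
        integral {0..1} (\<lambda>s. m s * ?D (?P s q) v) + integral {0..1} (\<lambda>s. (m s * s) * ?D (?P s q) (L v))"
      if "q \<in> W" for q v
    proof -
      have "B q integrable_on cbox 0 1"
        using slice[OF cB that] integrable_continuous_real by auto
      then have "integral (cbox 0 1) (B q) v = integral {0..1} (\<lambda>s. B q s v)"
        by (simp add: blinfun_apply_integral)
      also have "\<dots> = integral {0..1} (\<lambda>s. m s * ?D (?P s q) v + (m s * s) * ?D (?P s q) (L v))"
        by (rule integral_cong) (simp add: B E that)
      also have "\<dots> = integral {0..1} (\<lambda>s. m s * ?D (?P s q) v) + integral {0..1} (\<lambda>s. (m s * s) * ?D (?P s q) (L v))"
        by (intro integral_add integrable_continuous_real slice[OF _ that] C cD ms Suc.prems)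
      finally show ?thesis .
    qed
    have hasD: "((\<lambda>q. integral {0..1} (\<lambda>s. m s * h (?P s q))) has_derivative
        (\<lambda>v. integral {0..1} (\<lambda>s. m s * ?D (?P s q) v) + integral {0..1} (\<lambda>s. (m s * s) * ?D (?P s q) (L v)))) (at q)"
      if "q \<in> W" for q
    proof -
      have "blinfun_apply (integral (cbox 0 1) (B q)) = (\<lambda>v. integral {0..1} (\<lambda>s. m s * ?D (?P s q) v)
          + integral {0..1} (\<lambda>s. (m s * s) * ?D (?P s q) (L v)))"
        using split[OF that] by (rule ext)
      with leibniz[OF that] show ?thesis
        unfolding at_within_open[OF that \<open>open W\<close>] cbox_interval by metis
    qed
    show ?case
      by (rule Ck_on_SucI[OF \<open>open W\<close> hasD])
        (auto intro!: Ck_on_add[OF \<open>open W\<close>] Suc.IH D(2) ms Suc.prems)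
  qed
qed

section \<open>Smooth functions and tangent vectors on submanifolds\<close>

lemma smooth_local:
  assumes "\<And>p. p \<in> M \<Longrightarrow> \<exists>U g. open U \<and> p \<in> U \<and> (\<forall>k. Ck_on k U g) \<and> (\<forall>q\<in>M \<inter> U. g q = f q)"
  shows "smooth M f"
  using assms unfolding smooth_def by blast

lemma smooth_const: "smooth M (\<lambda>_. c)"
  unfolding smooth_def using Ck_on_const open_UNIV by blast

lemma smooth_bounded_linear: "bounded_linear f \<Longrightarrow> smooth M f"
  unfolding smooth_def using Ck_on_bounded_linear open_UNIV by blast

lemma smooth_bilinear:
  assumes "bounded_bilinear bb" "smooth M f" "smooth M g"
  shows "smooth M (\<lambda>x. bb (f x) (g x))"
proof (rule smooth_local)
  fix p assume "p \<in> M"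
  then obtain U f' V g' where "open U" "p \<in> U" "\<forall>k. Ck_on k U f'" "\<forall>q\<in>M \<inter> U. f' q = f q"
    "open V" "p \<in> V" "\<forall>k. Ck_on k V g'" "\<forall>q\<in>M \<inter> V. g' q = g q"
    using assms(2,3) unfolding smooth_def by meson
  then show "\<exists>U h. open U \<and> p \<in> U \<and> (\<forall>k. Ck_on k U h) \<and> (\<forall>q\<in>M \<inter> U. h q = bb (f q) (g q))"
    by (intro exI[of _ "U \<inter> V"] exI[of _ "\<lambda>x. bb (f' x) (g' x)"])
      (auto intro!: Ck_on_bilinear[OF assms(1)] intro: Ck_on_subset)
qed

lemma smooth_add:
  assumes "smooth M f" "smooth M g"
  shows "smooth M (\<lambda>x. f x + g x)"
proof (rule smooth_local)
  fix p assume "p \<in> M"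
  then obtain U f' V g' where "open U" "p \<in> U" "\<forall>k. Ck_on k U f'" "\<forall>q\<in>M \<inter> U. f' q = f q"
    "open V" "p \<in> V" "\<forall>k. Ck_on k V g'" "\<forall>q\<in>M \<inter> V. g' q = g q"
    using assms unfolding smooth_def by meson
  then show "\<exists>U h. open U \<and> p \<in> U \<and> (\<forall>k. Ck_on k U h) \<and> (\<forall>q\<in>M \<inter> U. h q = f q + g q)"
    by (intro exI[of _ "U \<inter> V"] exI[of _ "\<lambda>x. f' x + g' x"])
      (auto intro!: Ck_on_add intro: Ck_on_subset)
qed

lemma smooth_inverse:
  fixes f :: "'a::euclidean_space \<Rightarrow> real"
  assumes "smooth M f" "\<And>x. x \<in> M \<Longrightarrow> f x \<noteq> 0"
  shows "smooth M (\<lambda>x. inverse (f x))"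
proof (rule smooth_local)
  fix p assume "p \<in> M"
  then obtain U f' where U: "open U" "p \<in> U" "\<forall>k. Ck_on k U f'" "\<forall>q\<in>M \<inter> U. f' q = f q"
    using assms(1) unfolding smooth_def by meson
  let ?V = "{x \<in> U. f' x \<noteq> 0}"
  have "?V = U \<inter> f' -` (- {0})"
    by auto
  moreover have "open (U \<inter> f' -` (- {0}))"
    using U Ck_on_imp_continuous_on[of 0 U f'] by (intro continuous_open_preimage) auto
  ultimately have "open ?V"
    by simp
  with U assms(2) \<open>p \<in> M\<close>
  show "\<exists>U h. open U \<and> p \<in> U \<and> (\<forall>k. Ck_on k U h) \<and> (\<forall>q\<in>M \<inter> U. h q = inverse (f q))"
    by (intro exI[of _ ?V] exI[of _ "\<lambda>x. inverse (f' x)"])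
      (auto intro!: Ck_on_inverse intro: Ck_on_subset)
qed

lemmas smooth_scaleR = smooth_bilinear[OF bounded_bilinear_scaleR]
  and smooth_mult = smooth_bilinear[OF bounded_bilinear_mult]
  and smooth_inner = smooth_bilinear[OF bounded_bilinear_inner]
  and smooth_nth = smooth_bounded_linear[OF bounded_linear_vec_nth]

lemma smooth_minus:
  assumes "smooth M f"
  shows "smooth M (\<lambda>x. - f x)"
  using smooth_scaleR[OF smooth_const[of _ "-1"] assms] by simp

lemma smooth_diff:
  assumes "smooth M f" "smooth M g"
  shows "smooth M (\<lambda>x. f x - g x)"
  using smooth_add[OF assms(1) smooth_minus[OF assms(2)]] by simp

lemma smooth_power:
  fixes f :: "'a::euclidean_space \<Rightarrow> real"
  assumes "smooth M f"
  shows "smooth M (\<lambda>x. f x ^ n)"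
  by (induction n) (auto intro: smooth_const smooth_mult assms)

lemma smooth_component:
  assumes "smooth M (f :: 'a::euclidean_space \<Rightarrow> real ^ 'n)"
  shows "smooth M (\<lambda>x. f x $ i)"
  using smooth_inner[OF assms smooth_const[of _ "axis i 1"]] by (simp add: inner_axis)

lemmas smooth_intros = smooth_const smooth_scaleR smooth_mult smooth_inner smooth_nth smooth_add
  smooth_minus smooth_diff smooth_power smooth_component

lemma smooth_differentiable_within:
  assumes "smooth M f" "p \<in> M"
  shows "f differentiable (at p within M)"
proof -
  obtain U g where U: "open U" "p \<in> U" "\<forall>k. Ck_on k U g" "\<forall>q\<in>M \<inter> U. g q = f q"
    using assms unfolding smooth_def by meson
  then obtain d where "d > 0" and d: "ball p d \<subseteq> U"
    using openE by blast
  have "(g has_derivative frechet_derivative g (at p)) (at p within M)"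
    using Ck_on_SucD(1)[of 0 U g] U has_derivative_at_withinI by blast
  then have "(f has_derivative frechet_derivative g (at p)) (at p within M)"
    using \<open>d > 0\<close> \<open>p \<in> M\<close>
  proof (rule has_derivative_transform_within)
    show "g q = f q" if "q \<in> M" "dist q p < d" for q
      using that d U(4) by (auto simp: dist_commute subset_iff)
  qed
  then show ?thesis
    by (auto simp: differentiable_def)
qed

lemma smooth_has_diff_on:
  assumes "smooth M f" "p \<in> M"
  shows "(f has_derivative diff_on M f p) (at p within M)"
  using smooth_differentiable_within[OF assms] frechet_derivative_works
  unfolding diff_on_def[abs_def] by metis

text \<open>
  A derivative within \<open>M\<close> is determined on the tangent vectors of \<open>M\<close>, because there it is the
  derivative along a curve in \<open>M\<close>. Applied to a constant \<open>g\<close>, this also gives the linear equations that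
  tangent vectors satisfy.
\<close>

lemma derivative_along_tangent:
  assumes "v \<in> tangent_space M p" "(f has_derivative D) (at p within M)"
    "(g has_derivative D') (at p within M)" "\<And>q. q \<in> M \<Longrightarrow> f q = g q"
  shows "D v = D' v"
proof -
  obtain \<gamma> where \<gamma>: "\<gamma> 0 = p" "\<And>t. \<gamma> t \<in> M" "(\<gamma> has_vector_derivative v) (at (0::real))"
    using assms(1) by (auto simp: tangent_space_def)
  have chain: "((h \<circ> \<gamma>) has_vector_derivative E v) (at 0)" if "(h has_derivative E) (at p within M)" for h E
  proof -
    have "(h has_derivative E) (at (\<gamma> 0) within range \<gamma>)"
      unfolding \<gamma>(1) by (rule has_derivative_subset[OF that]) (use \<gamma>(2) in auto)
    from vector_derivative_diff_chain_within[OF \<gamma>(3) this] show ?thesis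
      by simp
  qed
  have "f \<circ> \<gamma> = g \<circ> \<gamma>"
    using assms(4) \<gamma>(2) by auto
  then show ?thesis
    using chain[OF assms(2)] chain[OF assms(3)] vector_derivative_unique_at by metis
qed

lemma diff_on_eqI:
  assumes "v \<in> tangent_space M p" "(f has_derivative D) (at p within M)"
  shows "diff_on M f p v = D v"
proof (rule derivative_along_tangent[OF assms(1) _ assms(2)])
  show "(f has_derivative diff_on M f p) (at p within M)"
    using assms(2) frechet_derivative_works unfolding diff_on_def[abs_def] differentiable_def by metis
qed simp

text \<open>
  The convention \<open>sgn 0 = 0\<close> makes the formula valid for \<open>v = 0\<close> as well.
\<close>

lemma great_circle:
  fixes p v :: "'a::euclidean_space"
  assumes "norm p = 1" "p \<bullet> v = 0"
  defines "\<gamma> \<equiv> \<lambda>t::real. cos (norm v * t) *\<^sub>R p + sin (norm v * t) *\<^sub>R sgn v"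
  shows "\<gamma> 0 = p" "norm (\<gamma> t) = 1" "(\<gamma> has_vector_derivative v) (at 0)"
proof -
  show "\<gamma> 0 = p"
    by (simp add: \<gamma>_def)
  show "norm (\<gamma> t) = 1"
  proof (cases "v = 0")
    case True
    then show ?thesis using assms(1) by (simp add: \<gamma>_def)
  next
    case False
    have [simp]: "p \<bullet> p = 1" "p \<bullet> sgn v = 0" "sgn v \<bullet> p = 0" "sgn v \<bullet> sgn v = 1"
      using assms(1,2) False by (auto simp: sgn_div_norm norm_eq_1 inner_commute dot_square_norm power2_eq_square)
    show ?thesis
      by (simp add: norm_eq_1 \<gamma>_def inner_add_left inner_add_right flip: power2_eq_square)
  qed
  have "norm v *\<^sub>R sgn v = v"
    by (cases "v = 0") (simp_all add: sgn_div_norm)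
  then show "(\<gamma> has_vector_derivative v) (at 0)"
    unfolding \<gamma>_def by (auto intro!: derivative_eq_intros)
qed

lemma tangent_space_S3:
  assumes "p \<in> S3"
  shows "tangent_space S3 p = {v. p \<bullet> v = 0}"
proof (intro subset_antisym subsetI)
  fix v assume v: "v \<in> tangent_space S3 p"
  have "((\<lambda>q. q \<bullet> q) has_derivative (\<lambda>h. p \<bullet> h + h \<bullet> p)) (at p within S3)"
    by (auto intro!: derivative_eq_intros)
  from derivative_along_tangent[OF v this has_derivative_const[of 1]]
  show "v \<in> {v. p \<bullet> v = 0}"
    by (simp add: S3_def norm_eq_1 inner_commute)
next
  fix v assume "v \<in> {v. p \<bullet> v = 0}"
  with great_circle[of p v] assms show "v \<in> tangent_space S3 p"
    unfolding tangent_space_def S3_def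
    by (auto intro!: exI[of _ "\<lambda>t. cos (norm v * t) *\<^sub>R p + sin (norm v * t) *\<^sub>R sgn v"])
qed

lemma tangent_space_S2:
  assumes "p \<in> S2"
  shows "tangent_space S2 p = {v. p \<bullet> v = 0 \<and> v $ 1 = 0}"
proof (intro subset_antisym subsetI)
  fix v assume v: "v \<in> tangent_space S2 p"
  have "((\<lambda>q. q \<bullet> q) has_derivative (\<lambda>h. p \<bullet> h + h \<bullet> p)) (at p within S2)"
    by (auto intro!: derivative_eq_intros)
  from derivative_along_tangent[OF v this has_derivative_const[of 1]]
  have 1: "p \<bullet> v = 0"
    by (simp add: S2_def S3_def norm_eq_1 inner_commute)
  have "((\<lambda>q::real^4. q $ 1) has_derivative (\<lambda>h. h $ 1)) (at p within S2)"
    by (intro bounded_linear_imp_has_derivative bounded_linear_vec_nth)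
  from derivative_along_tangent[OF v this has_derivative_const[of 0]] 1
  show "v \<in> {v. p \<bullet> v = 0 \<and> v $ 1 = 0}"
    by (simp add: S2_def)
next
  fix v assume "v \<in> {v. p \<bullet> v = 0 \<and> v $ 1 = 0}"
  then have v: "p \<bullet> v = 0" "v $ 1 = 0" and p: "norm p = 1" "p $ 1 = 0"
    using assms by (auto simp: S2_def S3_def)
  have "sgn v $ 1 = 0"
    using v by (simp add: sgn_div_norm)
  with great_circle[OF p(1) v(1)] p
  show "v \<in> tangent_space S2 p"
    unfolding tangent_space_def S2_def S3_def
    by (auto intro!: exI[of _ "\<lambda>t. cos (norm v * t) *\<^sub>R p + sin (norm v * t) *\<^sub>R sgn v"])
qed

section \<open>The logarithmic component of a b-vector field\<close>

text \<open>
  Hadamard's lemma: a function vanishing on the hyperplane \<open>x1 = 0\<close> is \<open>x1\<close> times the mean of its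
  \<open>x1\<close>-derivative over the segment to the hyperplane. As \<open>g\<close> is only known to vanish on the sphere,
  it is first made constant along rays; the radial projection preserves \<open>x1 = 0\<close>, so the new function
  vanishes on a piece of the whole hyperplane.
\<close>

lemma hadamard_division:
  fixes g :: "real^4 \<Rightarrow> real"
  assumes "smooth S3 g" "\<And>q. q \<in> S2 \<Longrightarrow> g q = 0" "p \<in> S2"
  shows "\<exists>\<epsilon>>0. \<exists>G. (\<forall>k. Ck_on k (ball p \<epsilon>) G) \<and> (\<forall>q\<in>S3 \<inter> ball p \<epsilon>. g q = q $ 1 * G q)"
proof -
  have p: "norm p = 1" "p $ 1 = 0" "p \<in> S3"
    using assms(3) by (auto simp: S2_def S3_def)
  obtain U g' where U: "open U" "p \<in> U" "\<And>k. Ck_on k U g'" "\<And>q. q \<in> S3 \<inter> U \<Longrightarrow> g' q = g q"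
    using assms(1) p(3) unfolding smooth_def by meson
  let ?N = "- {0 :: real^4}"
  define r :: "real^4 \<Rightarrow> real^4" where "r q = inverse (norm q) *\<^sub>R q" for q
  have rC: "Ck_on k ?N r" for k
    unfolding r_def
    by (intro Ck_on_bilinear[OF bounded_bilinear_scaleR] Ck_on_inverse Ck_on_norm Ck_on_bounded_linear
        bounded_linear_ident) (auto simp: open_Compl)
  have "open (?N \<inter> r -` U)"
    using U(1) Ck_on_imp_continuous_on[OF rC[of 0]] by (intro continuous_open_preimage) auto
  moreover have "p \<in> ?N \<inter> r -` U"
    using p U(2) by (auto simp: r_def)
  ultimately obtain \<epsilon> where \<epsilon>: "\<epsilon> > 0" and sub: "ball p \<epsilon> \<subseteq> ?N \<inter> r -` U"
    using openE by blast
  let ?W = "ball p \<epsilon>" and ?e = "axis 1 1 :: real^4"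
  define F where "F q = g' (r q)" for q
  have FC: "Ck_on k ?W F" for k
    unfolding F_def
    by (rule Ck_on_compose[OF open_ball U(3) Ck_on_subset[OF rC]]) (use sub in auto)
  note FD = Ck_on_SucD(1)[OF FC]
  \<comment> \<open>\<open>q + s *\<^sub>R L q\<close> runs from \<open>q\<close> at \<open>s = 0\<close> to its projection to the hyperplane \<open>x1 = 0\<close> at \<open>s = 1\<close>.\<close>
  define L :: "real^4 \<Rightarrow> real^4" where "L q = - (q $ 1) *\<^sub>R ?e" for q
  have blL: "bounded_linear L"
    unfolding L_def
    by (intro bounded_linear_scaleR_left[THEN bounded_linear_compose] bounded_linear_minus bounded_linear_vec_nth)
  have W: "q + s *\<^sub>R L q \<in> ?W" if "q \<in> ?W" "s \<in> {0..1}" for q s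
  proof -
    have "\<bar>(q + s *\<^sub>R L q - p) $ i\<bar> \<le> \<bar>(q - p) $ i\<bar>" for i
    proof (cases "i = 1")
      case True
      have "(q + s *\<^sub>R L q - p) $ 1 = (1 - s) * q $ 1"
        using p(2) by (simp add: L_def algebra_simps)
      then show ?thesis
        using that(2) p(2) mult_left_le_one_le[of "\<bar>q $ 1\<bar>" "1 - s"] True by (simp add: abs_mult)
    qed (simp add: L_def axis_def)
    then have "norm (q + s *\<^sub>R L q - p) \<le> norm (q - p)"
      by (simp add: norm_le_componentwise_cart)
    then show ?thesis
      using that(1) by (simp add: dist_norm norm_minus_commute)
  qed
  define G where "G q = integral {0..1} (\<lambda>s. 1 * frechet_derivative F (at (q + s *\<^sub>R L q)) ?e)" for q
  have GC: "Ck_on k ?W G" for k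
    unfolding G_def
    by (rule Ck_on_integral_param[OF open_ball convex_ball blL W Ck_on_SucD(2)[OF FC]]) auto
  have "F q = q $ 1 * G q" if "q \<in> ?W" for q
  proof -
    have D: "((\<lambda>s. F (q + s *\<^sub>R L q)) has_vector_derivative
        - (q $ 1) * frechet_derivative F (at (q + s *\<^sub>R L q)) ?e) (at s within {0..1})"
      if "s \<in> {0..1}" for s
    proof -
      note F = FD[OF W[OF \<open>q \<in> ?W\<close> that]]
      have "((\<lambda>s. q + s *\<^sub>R L q) has_vector_derivative L q) (at s within {0..1})"
        by (auto intro!: derivative_eq_intros)
      from vector_derivative_diff_chain_within[OF this has_derivative_at_withinI[OF F]]
      show ?thesis
        using linear_scale[OF has_derivative_linear[OF F], of "- (q $ 1)" ?e] by (simp add: o_def L_def)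
    qed
    have I: "((\<lambda>s. - (q $ 1) * frechet_derivative F (at (q + s *\<^sub>R L q)) ?e) has_integral
        F (q + 1 *\<^sub>R L q) - F (q + 0 *\<^sub>R L q)) {0..1}"
      by (intro fundamental_theorem_of_calculus D) auto
    have zero: "F (q + 1 *\<^sub>R L q) = 0"
    proof -
      have "q + 1 *\<^sub>R L q \<in> ?N \<inter> r -` U"
        using W[OF that, of 1] sub by auto
      then have "r (q + 1 *\<^sub>R L q) \<in> S2 \<inter> S3 \<inter> U"
        by (auto simp: S2_def S3_def r_def L_def axis_def)
      then show ?thesis
        using U(4) assms(2) by (simp add: F_def)
    qed
    from integral_unique[OF I] show ?thesis
      unfolding integral_mult_right zero by (simp add: G_def)
  qed
  moreover have "F q = g q" if "q \<in> S3 \<inter> ?W" for q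
    using that sub U(4)[of q] by (auto simp: F_def r_def S3_def)
  ultimately show ?thesis
    using \<epsilon> GC by (intro exI[of _ \<epsilon>] conjI exI[of _ G]) auto
qed

abbreviation blog :: "real^4 \<Rightarrow> (real^4 \<Rightarrow> real^4) \<Rightarrow> real" where
  "blog \<equiv> dlog S3 S2 (\<lambda>p. p $ 1)"

text \<open>
  A \<open>b\<close>-vector field \<open>X\<close> has the five components \<open>X p $ i\<close> and \<open>blog p X\<close>, subject to the two relations
  \<open>p \<bullet> X p = 0\<close> and \<open>X p $ 1 = p $ 1 * blog p X\<close>. At points of \<open>S2\<close> the last component is not determined
  by the vector \<open>X p\<close>.
\<close>

lemma b_fieldD:
  assumes "X \<in> b_vector_fields S3 S2"
  shows "smooth S3 X" "p \<in> S3 \<Longrightarrow> X p \<in> tangent_space S3 p" "p \<in> S3 \<Longrightarrow> p \<bullet> X p = 0"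
    "p \<in> S2 \<Longrightarrow> X p $ 1 = 0"
  using assms tangent_space_S3 tangent_space_S2 by (auto simp: b_vector_fields_def)

lemma diff_on_first:
  assumes "v \<in> tangent_space S3 p"
  shows "diff_on S3 (\<lambda>p. p $ 1) p v = v $ 1"
  by (intro diff_on_eqI[OF assms] bounded_linear_imp_has_derivative bounded_linear_vec_nth)

text \<open>
  This makes the limit in the definition of \<open>dlog\<close> unique: the points of \<open>S2\<close> are reached from outside
  along great circles.
\<close>

lemma S2_islimpt:
  assumes "p \<in> S2"
  shows "p islimpt S3 - S2"
  unfolding islimpt_approachable
proof (intro allI impI)
  fix e :: real assume "e > 0"
  let ?v = "axis 1 1 :: real^4"
  define \<gamma> where "\<gamma> = (\<lambda>t. cos (norm ?v * t) *\<^sub>R p + sin (norm ?v * t) *\<^sub>R sgn ?v)"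
  have p: "norm p = 1" "p $ 1 = 0" "p \<bullet> ?v = 0"
    using assms by (auto simp: S2_def S3_def inner_axis)
  note gc = great_circle[OF p(1,3)]
  have "continuous (at 0) \<gamma>"
    unfolding \<gamma>_def by (intro continuous_intros)
  then obtain d where d: "d > 0" "\<And>t. dist t 0 < d \<Longrightarrow> dist (\<gamma> t) (\<gamma> 0) < e"
    unfolding continuous_at_eps_delta using \<open>e > 0\<close> by blast
  define t where "t = min (d / 2) 1"
  have t: "0 < t" "t < d" "t < pi"
    using d pi_gt3 by (auto simp: t_def)
  have "dist (\<gamma> t) p < e"
    using d(2)[of t] t gc(1) by (simp add: \<gamma>_def)
  moreover have "\<gamma> t $ 1 = sin t"
    by (simp add: \<gamma>_def p sgn_div_norm)
  then have "\<gamma> t $ 1 \<noteq> 0"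
    using sin_gt_zero[of t] t by simp
  moreover from this have "\<gamma> t \<noteq> p" "\<gamma> t \<notin> S2"
    using p(2) by (auto simp: S2_def)
  moreover have "\<gamma> t \<in> S3"
    using gc(2)[of t] by (simp add: \<gamma>_def S3_def)
  ultimately show "\<exists>x'\<in>S3 - S2. x' \<noteq> p \<and> dist x' p < e"
    by blast
qed

lemma blog_eqI:
  assumes X: "X \<in> b_vector_fields S3 S2" and p: "p \<in> S3"
    and g: "continuous (at p within S3) g" "\<epsilon> > 0"
      "\<And>q. q \<in> S3 \<inter> ball p \<epsilon> \<Longrightarrow> X q $ 1 = q $ 1 * g q"
  shows "blog p X = g p"
proof (cases "p \<in> S2")
  case False
  then have "p $ 1 \<noteq> 0"
    using p by (auto simp: S2_def)
  then show ?thesis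
    using False p g(2) g(3)[of p] diff_on_first[OF b_fieldD(2)[OF X p]] by (simp add: dlog_def)
next
  case True
  have "(g \<longlongrightarrow> g p) (at p within S3 - S2)"
    using g(1) unfolding continuous_within by (rule tendsto_within_subset) auto
  then have "((\<lambda>q. diff_on S3 (\<lambda>p. p $ 1) q (X q) / q $ 1) \<longlongrightarrow> g p) (at p within S3 - S2)"
  proof (rule Lim_transform_within[OF _ g(2)])
    fix q assume q: "q \<in> S3 - S2" "dist q p < \<epsilon>"
    then have "q $ 1 \<noteq> 0"
      by (auto simp: S2_def)
    then show "g q = diff_on S3 (\<lambda>p. p $ 1) q (X q) / q $ 1"
      using q g(3)[of q] diff_on_first[OF b_fieldD(2)[OF X]] by (simp add: dist_commute)
  qed
  moreover have "at p within S3 - S2 \<noteq> bot"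
    using S2_islimpt[OF True] trivial_limit_within by blast
  ultimately show ?thesis
    using True by (simp add: dlog_def tendsto_Lim)
qed

lemma smooth_continuous_within: "smooth M f \<Longrightarrow> p \<in> M \<Longrightarrow> continuous (at p within M) f"
  using smooth_differentiable_within differentiable_imp_continuous_within by blast

lemma blog_eqI_smooth:
  assumes "X \<in> b_vector_fields S3 S2" "p \<in> S3" "smooth S3 g"
    "\<And>q. q \<in> S3 \<Longrightarrow> X q $ 1 = q $ 1 * g q"
  shows "blog p X = g p"
  using assms by (intro blog_eqI[of X p g 1] smooth_continuous_within) auto

text \<open>
  This is the content of the statement that \<open>dz/z\<close> is a smooth \<open>b\<close>-form; near \<open>S2\<close> it is the division
  lemma.
\<close>

lemma smooth_blog:
  assumes X: "X \<in> b_vector_fields S3 S2"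
  shows "smooth S3 (\<lambda>p. blog p X)"
proof (rule smooth_local)
  fix p assume p: "p \<in> S3"
  show "\<exists>U g. open U \<and> p \<in> U \<and> (\<forall>k. Ck_on k U g) \<and> (\<forall>q\<in>S3 \<inter> U. g q = blog q X)"
  proof (cases "p \<in> S2")
    case True
    have "smooth S3 (\<lambda>q. X q $ 1)"
      by (rule smooth_component[OF b_fieldD(1)[OF X]])
    from hadamard_division[OF this b_fieldD(4)[OF X] True]
    obtain \<epsilon> G where G: "\<epsilon> > 0" "\<And>k. Ck_on k (ball p \<epsilon>) G"
      "\<And>q. q \<in> S3 \<inter> ball p \<epsilon> \<Longrightarrow> X q $ 1 = q $ 1 * G q"
      by blast
    have "G q = blog q X" if q: "q \<in> S3 \<inter> ball p \<epsilon>" for q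
    proof -
      obtain d where d: "d > 0" "ball q d \<subseteq> ball p \<epsilon>"
        using q openE[OF open_ball, of q p \<epsilon>] by auto
      have "isCont G q"
        using Ck_on_imp_continuous_on[OF G(2)[of 0]] q by (simp add: continuous_on_eq_continuous_at)
      then have "continuous (at q within S3) G"
        by (rule continuous_at_imp_continuous_at_within)
      moreover have "X q' $ 1 = q' $ 1 * G q'" if "q' \<in> S3 \<inter> ball q d" for q'
        using that d(2) by (intro G(3)) blast
      ultimately show ?thesis
        using blog_eqI[OF X _ _ d(1), of q G] q by simp
    qed
    then show ?thesis
      using G by (intro exI[of _ "ball p \<epsilon>"] exI[of _ G]) auto
  next
    case False
    obtain U h where U: "open U" "p \<in> U" "\<And>k. Ck_on k U h" "\<And>q. q \<in> S3 \<inter> U \<Longrightarrow> h q = X q $ 1"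
      using smooth_component[OF b_fieldD(1)[OF X], of 1] p unfolding smooth_def by meson
    let ?V = "U \<inter> {q. q $ 1 \<noteq> 0}"
    have V: "open ?V"
      by (intro open_Int U(1) open_Collect_neq continuous_intros)
    have "Ck_on k ?V (\<lambda>q. h q * inverse (q $ 1))" for k
      by (intro Ck_on_bilinear[OF bounded_bilinear_mult V] Ck_on_inverse V Ck_on_subset[OF U(3)]
          Ck_on_bounded_linear bounded_linear_vec_nth) auto
    moreover have "h q * inverse (q $ 1) = blog q X" if "q \<in> S3 \<inter> ?V" for q
      using that U(4)[of q] diff_on_first[OF b_fieldD(2)[OF X]]
      by (auto simp: dlog_def S2_def divide_inverse)
    moreover have "p \<in> ?V"
      using False p U(2) by (auto simp: S2_def)
    ultimately show ?thesis
      using V by (intro exI[of _ ?V] exI[of _ "\<lambda>q. h q * inverse (q $ 1)"]) auto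
  qed
qed

lemma first_component_blog:
  assumes X: "X \<in> b_vector_fields S3 S2" and p: "p \<in> S3"
  shows "X p $ 1 = p $ 1 * blog p X"
proof (cases "p \<in> S2")
  case True
  then show ?thesis
    using b_fieldD(4)[OF X] by (simp add: S2_def)
next
  case False
  then show ?thesis
    using p diff_on_first[OF b_fieldD(2)[OF X p]] by (auto simp: dlog_def S2_def)
qed

lemma b_fieldI:
  assumes "smooth S3 X" "\<And>p. p \<in> S3 \<Longrightarrow> p \<bullet> X p = 0" "\<And>p. p \<in> S3 \<Longrightarrow> p $ 1 = 0 \<Longrightarrow> X p $ 1 = 0"
  shows "X \<in> b_vector_fields S3 S2"
  using assms tangent_space_S3 tangent_space_S2 by (auto simp: b_vector_fields_def S2_def)

lemma blog_linear:
  assumes "smooth S3 f" and X: "X \<in> b_vector_fields S3 S2" and Y: "Y \<in> b_vector_fields S3 S2"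
    and "p \<in> S3"
  shows "blog p (\<lambda>q. f q *\<^sub>R X q + Y q) = f p * blog p X + blog p Y"
proof (rule blog_eqI_smooth[where g = "\<lambda>p. f p * blog p X + blog p Y"])
  show "(\<lambda>q. f q *\<^sub>R X q + Y q) \<in> b_vector_fields S3 S2"
    using b_fieldD[OF X] b_fieldD[OF Y] assms(1)
    by (intro b_fieldI smooth_intros) (auto simp: inner_add_right S2_def)
qed (auto intro!: smooth_intros smooth_blog assms simp: first_component_blog[OF X] first_component_blog[OF Y] algebra_simps)

section \<open>The contact form and its differential\<close>

text \<open>
  The derivatives of \<open>X\<close> and \<open>Y\<close> cancel against the Lie bracket.
\<close>

lemma ext_deriv_inner:
  assumes "(B has_derivative DB) (at p within M)" "smooth M X" "smooth M Y" "p \<in> M"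
    "X p \<in> tangent_space M p" "Y p \<in> tangent_space M p"
  shows "ext_deriv M (\<lambda>q V. B q \<bullet> V q) p X Y = DB (X p) \<bullet> Y p - DB (Y p) \<bullet> X p"
proof -
  have "diff_on M (\<lambda>q. B q \<bullet> V q) p v = B p \<bullet> diff_on M V p v + DB v \<bullet> V p"
    if "smooth M V" "v \<in> tangent_space M p" for V v
    by (intro diff_on_eqI[OF that(2)] has_derivative_inner assms(1) smooth_has_diff_on[OF that(1) assms(4)])
  then show ?thesis
    using assms by (simp add: ext_deriv_def lie_bracket_def inner_diff_right)
qed

text \<open>
  The vector field dual to \<open>dy1/4 + X dy2 - y2 dX\<close> with \<open>X = x2 - x1\<^sup>2/10\<close>.
\<close>

definition beta_vec :: "real^4 \<Rightarrow> real^4" where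
  "beta_vec p = (p $ 4 * p $ 1 / 5) *\<^sub>R axis 1 1 + (1 / 4) *\<^sub>R axis 2 1
     + (- p $ 4) *\<^sub>R axis 3 1 + (p $ 3 - (p $ 1)\<^sup>2 / 10) *\<^sub>R axis 4 1"

text \<open>
  \<open>\<alpha> = - y1 dx1/x1 + dy1/4 + X dy2 - y2 dX\<close>. The closed summand \<open>dy1/4\<close> does not affect \<open>d\<alpha>\<close>; its
  coefficient is chosen so that \<open>\<alpha>\<close> takes the value \<open>scale\<close> on the Hamiltonian field below, a positive
  definite quadratic form.
\<close>

definition alpha :: "real^4 \<Rightarrow> (real^4 \<Rightarrow> real^4) \<Rightarrow> real" where
  "alpha p X = - p $ 2 * blog p X + beta_vec p \<bullet> X p"

definition dalpha :: "real^4 \<Rightarrow> (real^4 \<Rightarrow> real^4) \<Rightarrow> (real^4 \<Rightarrow> real^4) \<Rightarrow> real" where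
  "dalpha p X Y = wedge11 (\<lambda>x V. diff_on S3 (\<lambda>p. - p $ 2) x (V x)) blog p X Y
     + ext_deriv S3 (\<lambda>q V. beta_vec q \<bullet> V q) p X Y"

lemma smooth_divide_const: "smooth M f \<Longrightarrow> smooth M (\<lambda>x. f x / c)" for f :: "_ \<Rightarrow> real"
  unfolding divide_inverse by (intro smooth_mult smooth_const)

lemma smooth_beta: "smooth M beta_vec"
  unfolding beta_vec_def[abs_def] by (intro smooth_intros smooth_divide_const)

lemma inner4: "x \<bullet> y = x $ 1 * y $ 1 + x $ 2 * y $ 2 + x $ 3 * y $ 3 + x $ 4 * y $ 4" for x y :: "real^4"
  by (simp add: inner_vec_def sum_4)

lemma b_form1_alpha: "b_form1 S3 S2 alpha"
  unfolding b_form1_def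
proof (intro conjI ballI allI impI)
  show "smooth S3 (\<lambda>p. alpha p X)" if "X \<in> b_vector_fields S3 S2" for X
    unfolding alpha_def
    by (intro smooth_intros smooth_blog smooth_beta b_fieldD(1) that)
  show "alpha p (\<lambda>q. f q *\<^sub>R X q + Y q) = f p * alpha p X + alpha p Y"
    if "smooth S3 f" "X \<in> b_vector_fields S3 S2" "Y \<in> b_vector_fields S3 S2" "p \<in> S3" for f X Y p
    unfolding alpha_def blog_linear[OF that] by (simp add: inner_add_right algebra_simps)
qed

lemma b_form1_beta: "b_form1 S3 {} (\<lambda>q V. beta_vec q \<bullet> V q)"
  unfolding b_form1_def b_vector_fields_def
  by (auto intro!: smooth_intros smooth_beta simp: inner_add_right)

lemma has_b_ext_deriv_alpha: "has_b_ext_deriv S3 S2 alpha dalpha"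
  unfolding has_b_ext_deriv_def
  by (intro ballI exI[of _ UNIV] exI[of _ "\<lambda>p. p $ 1"] exI[of _ "\<lambda>p. - p $ 2"]
      exI[of _ "\<lambda>q V. beta_vec q \<bullet> V q"])
    (auto simp: defining_function_S3 b_form1_beta alpha_def dalpha_def intro!: smooth_intros)

text \<open>
  In coordinates this is \<open>d\<alpha> = dx1/x1 \<and> dy1 + 2 dX \<and> dy2\<close>.
\<close>

lemma dalpha_formula:
  assumes X: "X \<in> b_vector_fields S3 S2" and Y: "Y \<in> b_vector_fields S3 S2" and p: "p \<in> S3"
  shows "dalpha p X Y = - (X p $ 2 * blog p Y - Y p $ 2 * blog p X)
     + 2 * (X p $ 3 * Y p $ 4 - X p $ 4 * Y p $ 3)
     + 2 / 5 * p $ 1 * (X p $ 4 * Y p $ 1 - Y p $ 4 * X p $ 1)"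
proof -
  note nth = bounded_linear_imp_has_derivative[OF bounded_linear_vec_nth]
  have y: "diff_on S3 (\<lambda>p. - p $ 2) p v = - v $ 2" if "v \<in> tangent_space S3 p" for v
    by (intro diff_on_eqI[OF that] has_derivative_minus nth)
  define DB :: "real^4 \<Rightarrow> real^4" where "DB h = (h $ 4 * p $ 1 / 5 + p $ 4 * h $ 1 / 5) *\<^sub>R axis 1 1
    + (- h $ 4) *\<^sub>R axis 3 1 + (h $ 3 - p $ 1 * h $ 1 / 5) *\<^sub>R axis 4 1" for h
  have DB: "(beta_vec has_derivative DB) (at p within S3)"
    unfolding beta_vec_def[abs_def] DB_def[abs_def]
    by (auto intro!: derivative_eq_intros nth simp: algebra_simps add_divide_distrib scaleR_add_left)
  show ?thesis
    using ext_deriv_inner[OF DB b_fieldD(1)[OF X] b_fieldD(1)[OF Y] p b_fieldD(2)[OF X p] b_fieldD(2)[OF Y p]]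
      y[OF b_fieldD(2)[OF X p]] y[OF b_fieldD(2)[OF Y p]]
    by (simp add: dalpha_def wedge11_def DB_def inner4 axis_def algebra_simps)
qed

section \<open>The Reeb field\<close>

text \<open>
  The field \<open>V\<close> with \<open>d\<alpha>(V, \<cdot>) = - d(\<bar>p\<bar>\<^sup>2/2)\<close>, where \<open>d\<alpha>\<close> is taken as a \<open>b\<close>-symplectic form on the whole
  space. It is tangent to the sphere and there it spans the kernel of \<open>d\<alpha>\<close>, so that the Reeb field
  is its multiple by \<open>1 / \<alpha>(V)\<close>.
\<close>

definition hamiltonian_field :: "real^4 \<Rightarrow> real^4" where
  "hamiltonian_field p = (- p $ 1 * p $ 2) *\<^sub>R axis 1 1 + ((p $ 1)\<^sup>2 * (1 + p $ 3 / 5)) *\<^sub>R axis 2 1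
     + (- p $ 4 / 2 - (p $ 1)\<^sup>2 * p $ 2 / 5) *\<^sub>R axis 3 1 + (p $ 3 / 2) *\<^sub>R axis 4 1"

text \<open>
  The value of \<open>\<alpha>\<close> on the Hamiltonian field; see \<open>alpha_reeb\<close>.
\<close>

definition scale :: "real^4 \<Rightarrow> real" where
  "scale p = (p $ 2)\<^sup>2 + (p $ 1)\<^sup>2 / 4 + ((p $ 3)\<^sup>2 + (p $ 4)\<^sup>2) / 2"

definition reeb :: "real^4 \<Rightarrow> real^4" where
  "reeb p = inverse (scale p) *\<^sub>R hamiltonian_field p"

lemma hamiltonian_field_nth:
  "hamiltonian_field p $ 1 = - p $ 1 * p $ 2"
  "hamiltonian_field p $ 2 = (p $ 1)\<^sup>2 * (1 + p $ 3 / 5)"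
  "hamiltonian_field p $ 3 = - p $ 4 / 2 - (p $ 1)\<^sup>2 * p $ 2 / 5"
  "hamiltonian_field p $ 4 = p $ 3 / 2"
  by (simp_all add: hamiltonian_field_def axis_def)

lemma S3_iff: "p \<in> S3 \<longleftrightarrow> (p $ 1)\<^sup>2 + (p $ 2)\<^sup>2 + (p $ 3)\<^sup>2 + (p $ 4)\<^sup>2 = 1"
  by (simp add: S3_def norm_eq_1 inner_vec_def sum_4 power2_eq_square)

lemma S3_component_le: "p \<in> S3 \<Longrightarrow> \<bar>p $ i\<bar> \<le> 1"
  using component_le_norm_cart[of p i] by (simp add: S3_def)

lemma scale_pos:
  assumes "p \<in> S3"
  shows "scale p > 0"
proof -
  have "1 / 4 * ((p $ 1)\<^sup>2 + (p $ 2)\<^sup>2 + (p $ 3)\<^sup>2 + (p $ 4)\<^sup>2) \<le> scale p"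
    using zero_le_power2[of "p $ 2"] zero_le_power2[of "p $ 3"] zero_le_power2[of "p $ 4"]
    unfolding scale_def by argo
  with assms show ?thesis
    by (simp add: S3_iff)
qed

lemma reeb_nth: "reeb p $ i = hamiltonian_field p $ i / scale p"
  by (simp add: reeb_def divide_inverse mult.commute)

lemma smooth_scale: "smooth M scale"
  unfolding scale_def[abs_def] by (intro smooth_intros smooth_divide_const)

lemma smooth_inverse_scale: "smooth S3 (\<lambda>p. inverse (scale p))"
  by (intro smooth_inverse smooth_scale) (use scale_pos in force)

lemma reeb_b_field: "reeb \<in> b_vector_fields S3 S2"
proof (rule b_fieldI)
  show "smooth S3 reeb"
    unfolding reeb_def[abs_def] hamiltonian_field_def
    by (intro smooth_intros smooth_divide_const smooth_inverse_scale)
  show "p \<bullet> reeb p = 0" for p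
    by (simp add: reeb_def inner4 hamiltonian_field_nth power2_eq_square algebra_simps)
  show "reeb p $ 1 = 0" if "p $ 1 = 0" for p
    using that by (simp add: reeb_nth hamiltonian_field_nth)
qed

lemma blog_reeb:
  assumes "p \<in> S3"
  shows "blog p reeb = - p $ 2 / scale p"
proof (rule blog_eqI_smooth[OF reeb_b_field assms])
  show "smooth S3 (\<lambda>p. - p $ 2 / scale p)"
    unfolding divide_inverse by (intro smooth_intros smooth_inverse_scale)
qed (simp add: reeb_nth hamiltonian_field_nth)

lemma alpha_reeb:
  assumes "p \<in> S3"
  shows "alpha p reeb = 1"
proof -
  have "alpha p reeb = (p $ 2 * p $ 2 + beta_vec p \<bullet> hamiltonian_field p) / scale p"
    using blog_reeb[OF assms] by (simp add: alpha_def reeb_def divide_inverse algebra_simps)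
  also have "p $ 2 * p $ 2 + beta_vec p \<bullet> hamiltonian_field p = scale p"
    by (simp add: inner4 beta_vec_def axis_def hamiltonian_field_nth scale_def power2_eq_square algebra_simps add_divide_distrib)
  finally show ?thesis
    using scale_pos[OF assms] by simp
qed

lemma dalpha_reeb:
  assumes Y: "Y \<in> b_vector_fields S3 S2" and p: "p \<in> S3"
  shows "dalpha p reeb Y = 0"
proof -
  have "dalpha p reeb Y = - (p \<bullet> Y p) / scale p"
    using scale_pos[OF p] unfolding dalpha_formula[OF reeb_b_field Y p]
    by (simp add: reeb_nth hamiltonian_field_nth blog_reeb[OF p] first_component_blog[OF Y p] inner4 field_simps power2_eq_square)
  then show ?thesis
    using b_fieldD(3)[OF Y p] by simp
qed

text \<open>
  Two families of test fields. \<open>tilt i\<close> is the rotation of the \<open>x1\<close>- and \<open>i\<close>-axes multiplied by \<open>x1\<close>, which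
  makes it tangent to \<open>S2\<close>. It vanishes on \<open>S2\<close> as a vector field, but not identically as a section of the
  \<open>b\<close>-tangent bundle.
  \<open>rotation i\<close> rotates the \<open>y1\<close>- and \<open>i\<close>-axes.
\<close>

definition tilt :: "4 \<Rightarrow> real^4 \<Rightarrow> real^4" where
  "tilt i p = p $ 1 *\<^sub>R (p $ 1 *\<^sub>R axis i 1 - p $ i *\<^sub>R axis 1 1)"

definition rotation :: "4 \<Rightarrow> real^4 \<Rightarrow> real^4" where
  "rotation i p = p $ 2 *\<^sub>R axis i 1 - p $ i *\<^sub>R axis 2 1"

lemma tilt_b_field: "i \<noteq> 1 \<Longrightarrow> tilt i \<in> b_vector_fields S3 S2"
  unfolding tilt_def[abs_def] by (intro b_fieldI smooth_intros) (simp_all add: inner_diff_right inner_axis)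

lemma rotation_b_field: "i \<noteq> 1 \<Longrightarrow> i \<noteq> 2 \<Longrightarrow> rotation i \<in> b_vector_fields S3 S2"
  unfolding rotation_def[abs_def]
  by (intro b_fieldI smooth_intros) (simp add: inner_diff_right inner_axis, simp add: axis_def)

lemma blog_tilt: "i \<noteq> 1 \<Longrightarrow> p \<in> S3 \<Longrightarrow> blog p (tilt i) = - p $ i"
  by (intro blog_eqI_smooth[OF tilt_b_field] smooth_intros) (simp_all add: tilt_def axis_def)

lemma blog_rotation: "i \<noteq> 1 \<Longrightarrow> i \<noteq> 2 \<Longrightarrow> p \<in> S3 \<Longrightarrow> blog p (rotation i) = 0"
  by (intro blog_eqI_smooth[OF rotation_b_field] smooth_intros) (simp_all add: rotation_def axis_def)

text \<open>
  The pair \<open>tilt 3, tilt 4\<close> serves where \<open>x1 \<noteq> 0\<close>, the pair \<open>rotation 3, rotation 4\<close> where \<open>y1 \<noteq> 0\<close>,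
  and where both vanish one of the pairs \<open>tilt i, rotation i\<close> does.
\<close>

lemma dalpha_nondegenerate:
  assumes p: "p \<in> S3"
  shows "\<exists>X\<in>b_vector_fields S3 S2. \<exists>Y\<in>b_vector_fields S3 S2. dalpha p X Y \<noteq> 0"
proof -
  have tilt_tilt: "dalpha p (tilt 3) (tilt 4) = (p $ 1)^4 * (2 + 2 / 5 * p $ 3)"
    unfolding dalpha_formula[OF tilt_b_field tilt_b_field p, of 3 4, simplified]
    by (simp add: tilt_def axis_def eval_nat_numeral algebra_simps)
  have rotation_rotation: "dalpha p (rotation 3) (rotation 4) = 2 * (p $ 2)\<^sup>2"
    using blog_rotation[OF _ _ p] dalpha_formula[OF rotation_b_field rotation_b_field p, of 3 4]
    by (simp add: rotation_def axis_def power2_eq_square)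
  have tilt_rotation: "dalpha p (tilt i) (rotation i) = (p $ i)\<^sup>2" if "p $ 1 = 0" "p $ 2 = 0" "i = 3 \<or> i = 4" for i
    using blog_rotation[OF _ _ p, of i] blog_tilt[OF _ p, of i] dalpha_formula[OF tilt_b_field rotation_b_field p, of i i] that
    by (auto simp: rotation_def tilt_def axis_def power2_eq_square)
  have fields: "tilt i \<in> b_vector_fields S3 S2" "rotation i \<in> b_vector_fields S3 S2" if "i = 3 \<or> i = 4" for i
    using that by (auto intro!: tilt_b_field rotation_b_field)
  show ?thesis
  proof (cases "p $ 1 = 0 \<and> p $ 2 = 0")
    case True
    then have "(p $ 3)\<^sup>2 \<noteq> 0 \<or> (p $ 4)\<^sup>2 \<noteq> 0"
      using p by (auto simp: S3_iff)
    then show ?thesis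
      using tilt_rotation[of 3] tilt_rotation[of 4] True fields[of 3] fields[of 4] by metis
  next
    case False
    have "2 + 2 / 5 * p $ 3 > 0"
      using S3_component_le[OF p, of 3] by auto
    with False have "dalpha p (tilt 3) (tilt 4) \<noteq> 0 \<or> dalpha p (rotation 3) (rotation 4) \<noteq> 0"
      by (auto simp: tilt_tilt rotation_rotation)
    then show ?thesis
      using fields by blast
  qed
qed

text \<open>
  As the Reeb field spans the kernel of \<open>d\<alpha>\<close> and \<open>\<alpha>\<close> is \<open>1\<close> on it, \<open>\<alpha> \<and> d\<alpha>\<close> on the triple \<open>R, X, Y\<close> is just
  \<open>d\<alpha>\<close> on the pair \<open>X, Y\<close>.
\<close>

lemma b_contact_alpha: "b_contact_form3 S3 S2 alpha"
  unfolding b_contact_form3_def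
proof (intro conjI exI[of _ dalpha] b_form1_alpha has_b_ext_deriv_alpha ballI)
  fix p assume p: "p \<in> S3"
  obtain X Y where X: "X \<in> b_vector_fields S3 S2" and Y: "Y \<in> b_vector_fields S3 S2" and "dalpha p X Y \<noteq> 0"
    using dalpha_nondegenerate[OF p] by blast
  then have "wedge12 alpha dalpha p reeb X Y \<noteq> 0"
    using p by (simp add: wedge12_def alpha_reeb dalpha_reeb)
  then show "\<exists>X\<in>b_vector_fields S3 S2. \<exists>Y\<in>b_vector_fields S3 S2. \<exists>W\<in>b_vector_fields S3 S2.
      wedge12 alpha dalpha p X Y W \<noteq> 0"
    using reeb_b_field X Y by blast
qed

lemma reeb_is_reeb_field: "reeb_b_vector_field S3 S2 alpha reeb"
  unfolding reeb_b_vector_field_def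
  using reeb_b_field has_b_ext_deriv_alpha dalpha_reeb alpha_reeb by blast

section \<open>Orbits outside the critical set\<close>

text \<open>
  By the mean value theorem the derivative takes the values \<open>f (n + 1) - f n\<close>, which tend to \<open>0\<close>, at times
  tending to infinity.
\<close>

lemma derivative_limit_zero:
  fixes f :: "real \<Rightarrow> real"
  assumes "\<And>t. (f has_real_derivative f' t) (at t)" "(f \<longlongrightarrow> a) at_top" "(f' \<longlongrightarrow> b) at_top"
  shows "b = 0"
proof -
  have "\<forall>n. \<exists>s. real n < s \<and> s < real n + 1 \<and> f (real n + 1) - f (real n) = f' s"
  proof
    fix n
    show "\<exists>s. real n < s \<and> s < real n + 1 \<and> f (real n + 1) - f (real n) = f' s"
      using MVT2[of "real n" "real n + 1" f f'] assms(1) by auto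
  qed
  then obtain s where s: "\<And>n. real n < s n" "\<And>n. f (real n + 1) - f (real n) = f' (s n)"
    by metis
  have "filterlim s at_top sequentially"
    by (rule filterlim_at_top_mono[OF filterlim_real_sequentially]) (simp add: s(1) less_imp_le)
  then have "(\<lambda>n. f (real n + 1) - f (real n)) \<longlonglongrightarrow> b"
    unfolding s(2) by (rule filterlim_compose[OF assms(3)])
  moreover have "(\<lambda>n. f (real n + 1) - f (real n)) \<longlonglongrightarrow> a - a"
    by (intro tendsto_diff filterlim_compose[OF assms(2)] filterlim_real_sequentially
        filterlim_at_top_mono[OF filterlim_real_sequentially, of "\<lambda>n. real n + 1"]) simp
  ultimately show ?thesis
    using LIMSEQ_unique by fastforce
qed

lemma derivative_limit_zero_bot:
  fixes f :: "real \<Rightarrow> real"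
  assumes "\<And>t. (f has_real_derivative f' t) (at t)" "(f \<longlongrightarrow> a) at_bot" "(f' \<longlongrightarrow> b) at_bot"
  shows "b = 0"
proof -
  have "((\<lambda>t. f (- t)) has_real_derivative - f' (- t)) (at t)" for t
    using DERIV_mirror[of f "f' (- t)" t] assms(1) by simp
  then have "- b = 0"
    by (rule derivative_limit_zero[where f = "\<lambda>t. f (- t)" and a = a])
      (use assms(2,3) in \<open>auto simp: filterlim_at_bot_mirror intro!: tendsto_minus\<close>)
  then show ?thesis
    by simp
qed

lemma mono_limit_at_top:
  fixes f :: "real \<Rightarrow> real"
  assumes "mono f" "(f \<longlongrightarrow> a) at_top"
  shows "f t \<le> a"
  by (rule tendsto_lowerbound[OF assms(2)])
    (auto intro!: eventually_at_top_linorderI[of t] monoD[OF assms(1)])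

lemma mono_limit_at_bot:
  fixes f :: "real \<Rightarrow> real"
  assumes "mono f" "(f \<longlongrightarrow> a) at_bot"
  shows "a \<le> f t"
proof (rule tendsto_upperbound[OF assms(2)])
  show "eventually (\<lambda>s. f s \<le> f t) at_bot"
    unfolding eventually_at_bot_linorder by (auto intro!: exI[of _ t] monoD[OF assms(1)])
qed auto

text \<open>
  The factor \<open>1 / scale\<close> changes all speeds by the same positive factor. What follows depends only on
  signs of speeds and on comparisons with the speed of \<open>y1\<close>, so the factor is harmless.
\<close>

locale outside_orbit =
  fixes \<gamma> :: "real \<Rightarrow> real^4"
  assumes curve: "integral_curve reeb \<gamma>" and outside: "range \<gamma> \<subseteq> S3 - S2"
begin

lemma on_S3: "\<gamma> t \<in> S3"
  using outside by auto

lemma first_nonzero: "\<gamma> t $ 1 \<noteq> 0"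
  using outside by (auto simp: S2_def)

lemma component_derivative:
  "((\<lambda>t. \<gamma> t $ i) has_real_derivative hamiltonian_field (\<gamma> t) $ i / scale (\<gamma> t)) (at t)"
proof -
  have "(\<gamma> has_vector_derivative reeb (\<gamma> t)) (at t)"
    using curve by (simp add: integral_curve_def)
  from bounded_linear.has_vector_derivative[OF bounded_linear_vec_nth this]
  show ?thesis
    by (simp add: has_real_derivative_iff_has_vector_derivative reeb_def divide_inverse mult.commute)
qed

lemmas y_derivative = component_derivative[of 2, unfolded hamiltonian_field_nth]
  and w_derivative = component_derivative[of 4, unfolded hamiltonian_field_nth]

lemma factor_bound: "4 / 5 \<le> 1 + \<gamma> t $ 3 / 5"
  using S3_component_le[OF on_S3, of t 3] by auto

lemma y_strict_mono: "strict_mono (\<lambda>t. \<gamma> t $ 2)"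
proof (rule strict_monoI)
  fix a b :: real assume "a < b"
  have "(\<gamma> t $ 1)\<^sup>2 * (1 + \<gamma> t $ 3 / 5) / scale (\<gamma> t) > 0" for t
    using factor_bound[of t] first_nonzero[of t] scale_pos[OF on_S3] by simp
  then show "\<gamma> a $ 2 < \<gamma> b $ 2"
    using DERIV_pos_imp_increasing[OF \<open>a < b\<close>, of "\<lambda>t. \<gamma> t $ 2"] y_derivative by blast
qed

lemma not_periodic:
  assumes "T > 0"
  shows "\<gamma> (t + T) \<noteq> \<gamma> t"
  using strict_monoD[OF y_strict_mono, of t "t + T"] assms by auto

text \<open>
  The coordinate \<open>X\<close>. In the time of the Hamiltonian field, \<open>X' = - y2/2\<close> and \<open>y2' = X/2 + x1\<^sup>2/20\<close>: the
  point \<open>(X, y2)\<close> rotates about the origin, driven by a force in the direction of \<open>y2\<close> that is positive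
  outside \<open>S2\<close>.
\<close>

definition shifted :: "real \<Rightarrow> real" where
  "shifted t = \<gamma> t $ 3 - (\<gamma> t $ 1)\<^sup>2 / 10"

lemma shifted_derivative:
  "(shifted has_real_derivative - \<gamma> t $ 4 / 2 / scale (\<gamma> t)) (at t)"
proof -
  have "(shifted has_real_derivative
      hamiltonian_field (\<gamma> t) $ 3 / scale (\<gamma> t) - 2 * \<gamma> t $ 1 * (hamiltonian_field (\<gamma> t) $ 1 / scale (\<gamma> t)) / 10) (at t)"
    unfolding shifted_def[abs_def]
    by (auto intro!: derivative_eq_intros component_derivative)
  then show ?thesis
    by (rule DERIV_cong) (use scale_pos[OF on_S3, of t] in \<open>simp add: hamiltonian_field_nth field_simps power2_eq_square\<close>)
qed

text \<open>
  The distance of \<open>(X, y2)\<close> from the origin, regularised by \<open>e > 0\<close> so that it is differentiable at the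
  origin too.
\<close>

definition radius :: "real \<Rightarrow> real \<Rightarrow> real" where
  "radius e t = sqrt ((shifted t)\<^sup>2 + (\<gamma> t $ 4)\<^sup>2 + e\<^sup>2)"

text \<open>
  The rotation does not change the radius, so only the force \<open>x1\<^sup>2/20\<close> counts. As \<open>y1' = x1\<^sup>2 (1 + x2/5)\<close>
  is at least \<open>4/5 x1\<^sup>2\<close>, the radius moves at most \<open>1/16\<close> times as fast as \<open>y1\<close>.
\<close>

lemma radius_speed:
  assumes "e > 0"
  obtains d where "(radius e has_real_derivative d) (at t)"
    "\<bar>d\<bar> \<le> 1 / 16 * ((\<gamma> t $ 1)\<^sup>2 * (1 + \<gamma> t $ 3 / 5) / scale (\<gamma> t))"
proof
  let ?w = "\<gamma> t $ 4" and ?k = "(\<gamma> t $ 1)\<^sup>2 / 20 / scale (\<gamma> t)"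
  have pos: "0 < (shifted t)\<^sup>2 + ?w\<^sup>2 + e\<^sup>2"
    using assms by (simp add: add_nonneg_pos)
  then have rpos: "radius e t > 0"
    by (simp add: radius_def)
  have "((\<lambda>t. (shifted t)\<^sup>2 + (\<gamma> t $ 4)\<^sup>2 + e\<^sup>2) has_real_derivative
      2 * shifted t * (- ?w / 2 / scale (\<gamma> t)) + 2 * ?w * (\<gamma> t $ 3 / 2 / scale (\<gamma> t))) (at t)"
    by (auto intro!: derivative_eq_intros shifted_derivative w_derivative simp: algebra_simps)
  then have "((\<lambda>t. (shifted t)\<^sup>2 + (\<gamma> t $ 4)\<^sup>2 + e\<^sup>2) has_real_derivative 2 * (?w * ?k)) (at t)"
    by (rule DERIV_cong) (simp add: shifted_def algebra_simps diff_divide_distrib)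
  from DERIV_chain2[OF DERIV_real_sqrt[OF pos] this]
  show "(radius e has_real_derivative ?w / radius e t * ?k) (at t)"
    unfolding radius_def[abs_def] by (rule DERIV_cong) (simp add: field_simps)
  have "\<bar>?w\<bar> \<le> radius e t"
    unfolding radius_def by (rule real_le_rsqrt) simp
  then have "\<bar>?w / radius e t\<bar> \<le> 1"
    using rpos by simp
  moreover have k0: "?k \<ge> 0"
    using scale_pos[OF on_S3] by (simp add: less_imp_le)
  ultimately have "\<bar>?w / radius e t * ?k\<bar> \<le> 1 * ?k"
    unfolding abs_mult by (intro mult_mono) auto
  also have "\<dots> = 1 / 16 * ((\<gamma> t $ 1)\<^sup>2 * (4 / 5) / scale (\<gamma> t))"
    by simp
  also have "\<dots> \<le> 1 / 16 * ((\<gamma> t $ 1)\<^sup>2 * (1 + \<gamma> t $ 3 / 5) / scale (\<gamma> t))"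
    using factor_bound scale_pos[OF on_S3, of t] by (intro mult_left_mono divide_right_mono) auto
  finally show "\<bar>?w / radius e t * ?k\<bar> \<le> 1 / 16 * ((\<gamma> t $ 1)\<^sup>2 * (1 + \<gamma> t $ 3 / 5) / scale (\<gamma> t))" .
qed

text \<open>
  With \<open>\<sigma> = 1\<close> the limit at \<open>+\<infinity>\<close> bounds the radius from above, with \<open>\<sigma> = -1\<close> the limit at \<open>-\<infinity>\<close> does.
\<close>

lemma radius_mono:
  assumes "e > 0" "\<bar>\<sigma>\<bar> = 1"
  shows "mono (\<lambda>t. \<gamma> t $ 2 / 16 + \<sigma> * radius e t)"
proof (rule monoI)
  fix a b :: real assume "a \<le> b"
  then show "\<gamma> a $ 2 / 16 + \<sigma> * radius e a \<le> \<gamma> b $ 2 / 16 + \<sigma> * radius e b"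
  proof (rule DERIV_nonneg_imp_nondecreasing)
    fix t
    obtain d where d: "(radius e has_real_derivative d) (at t)"
      "\<bar>d\<bar> \<le> 1 / 16 * ((\<gamma> t $ 1)\<^sup>2 * (1 + \<gamma> t $ 3 / 5) / scale (\<gamma> t))"
      using radius_speed[OF assms(1)] .
    have "((\<lambda>t. \<gamma> t $ 2 / 16 + \<sigma> * radius e t) has_real_derivative
        ((\<gamma> t $ 1)\<^sup>2 * (1 + \<gamma> t $ 3 / 5) / scale (\<gamma> t)) / 16 + \<sigma> * d) (at t)"
      by (intro DERIV_add DERIV_cmult DERIV_cdivide d(1) y_derivative)
    moreover have "\<bar>\<sigma> * d\<bar> = \<bar>d\<bar>"
      using assms(2) by (simp add: abs_mult)
    then have "0 \<le> ((\<gamma> t $ 1)\<^sup>2 * (1 + \<gamma> t $ 3 / 5) / scale (\<gamma> t)) / 16 + \<sigma> * d"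
      using d(2) by argo
    ultimately show "\<exists>y. ((\<lambda>t. \<gamma> t $ 2 / 16 + \<sigma> * radius e t) has_real_derivative y) (at t) \<and> 0 \<le> y"
      by blast
  qed
qed

text \<open>
  The velocity converges with the orbit, and its limit must be \<open>0\<close>: the ends of the orbit are zeros of
  the field. On \<open>S2\<close> these are the two poles \<open>y1 = 1\<close> and \<open>y1 = -1\<close>.
\<close>

lemma limit_is_zero_of_reeb:
  assumes F: "F = at_top \<or> F = at_bot" and lim: "(\<gamma> \<longlongrightarrow> p) F" and p: "p \<in> S2"
  shows "p $ 3 = 0" "p $ 4 = 0"
proof -
  have lp: "scale p \<noteq> 0"
    using scale_pos[of p] p by (simp add: S2_def)
  note c = tendsto_vec_nth[OF lim]
  have l: "((\<lambda>t. scale (\<gamma> t)) \<longlongrightarrow> scale p) F"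
    unfolding scale_def by (intro tendsto_intros c) auto
  have h: "((\<lambda>t. hamiltonian_field (\<gamma> t) $ i / scale (\<gamma> t)) \<longlongrightarrow> hamiltonian_field p $ i / scale p) F" if "i = 3 \<or> i = 4" for i
    using that by (elim disjE; simp only: hamiltonian_field_nth; intro tendsto_intros c l lp) auto
  have "hamiltonian_field p $ i / scale p = 0" if "i = 3 \<or> i = 4" for i
    using F
  proof (elim disjE)
    assume "F = at_top"
    show ?thesis
      by (rule derivative_limit_zero[OF component_derivative c[unfolded \<open>F = at_top\<close>] h[OF that, unfolded \<open>F = at_top\<close>]])
  next
    assume "F = at_bot"
    show ?thesis
      by (rule derivative_limit_zero_bot[OF component_derivative c[unfolded \<open>F = at_bot\<close>] h[OF that, unfolded \<open>F = at_bot\<close>]])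
  qed
  from this[of 3] this[of 4] show "p $ 3 = 0" "p $ 4 = 0"
    using lp p by (auto simp: hamiltonian_field_nth S2_def)
qed

lemma radius_limit:
  assumes F: "F = at_top \<or> F = at_bot" and lim: "(\<gamma> \<longlongrightarrow> p) F" and p: "p \<in> S2" and "e > 0"
  shows "(radius e \<longlongrightarrow> e) F"
proof -
  note c = tendsto_vec_nth[OF lim]
  have "(radius e \<longlongrightarrow> sqrt ((p $ 3 - (p $ 1)\<^sup>2 / 10)\<^sup>2 + (p $ 4)\<^sup>2 + e\<^sup>2)) F"
    unfolding radius_def[abs_def] shifted_def by (intro tendsto_intros c) auto
  moreover have "p $ 1 = 0"
    using p by (simp add: S2_def)
  ultimately show ?thesis
    using limit_is_zero_of_reeb[OF F lim p] \<open>e > 0\<close> by simp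
qed

text \<open>
  The radius starts and ends at \<open>0\<close> and moves at most \<open>1/16\<close> times as fast as \<open>y1\<close>, so it is at most
  \<open>1/16\<close> times the distance of \<open>y1\<close> from either of its limits, which lie in \<open>[-1, 1]\<close>.
\<close>

lemma radius_bound:
  assumes p: "p \<in> S2" "(\<gamma> \<longlongrightarrow> p) at_top" and q: "q \<in> S2" "(\<gamma> \<longlongrightarrow> q) at_bot"
  shows "sqrt ((shifted t)\<^sup>2 + (\<gamma> t $ 4)\<^sup>2) \<le> (1 - (\<gamma> t $ 2)\<^sup>2) / 16"
proof -
  let ?y = "\<gamma> t $ 2"
  have y: "\<bar>?y\<bar> \<le> 1" "p $ 2 \<le> 1" "- 1 \<le> q $ 2"
    using S3_component_le[of _ 2] on_S3[of t] p(1) q(1) by (auto simp: S2_def abs_le_iff)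
  have "sqrt ((shifted t)\<^sup>2 + (\<gamma> t $ 4)\<^sup>2) \<le> (1 - \<bar>?y\<bar>) / 16 + e" if "e > 0" for e
  proof -
    have "?y / 16 + 1 * radius e t \<le> p $ 2 / 16 + 1 * e"
      by (rule mono_limit_at_top[OF radius_mono]) (use that in \<open>auto intro!: tendsto_intros tendsto_vec_nth p radius_limit[OF _ p(2,1)]\<close>)
    moreover have "q $ 2 / 16 + (- 1) * e \<le> ?y / 16 + (- 1) * radius e t"
      by (rule mono_limit_at_bot[OF radius_mono]) (use that in \<open>auto intro!: tendsto_intros tendsto_vec_nth q radius_limit[OF _ q(2,1)]\<close>)
    moreover have "sqrt ((shifted t)\<^sup>2 + (\<gamma> t $ 4)\<^sup>2) \<le> radius e t"
      unfolding radius_def by simp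
    ultimately show ?thesis
      using y by argo
  qed
  then have "sqrt ((shifted t)\<^sup>2 + (\<gamma> t $ 4)\<^sup>2) \<le> (1 - \<bar>?y\<bar>) / 16"
    by (rule field_le_epsilon)
  moreover have "?y\<^sup>2 \<le> \<bar>?y\<bar>"
    using y(1) mult_left_le_one_le[of "\<bar>?y\<bar>" "\<bar>?y\<bar>"] by (simp add: power2_eq_square flip: abs_mult)
  ultimately show ?thesis
    by argo
qed

text \<open>
  The point is that \<open>1 - y1\<^sup>2 = x1\<^sup>2 + x2\<^sup>2 + y2\<^sup>2\<close> is nearly \<open>x1\<^sup>2\<close>: as \<open>X\<close>, \<open>y2\<close> and \<open>x1\<^sup>2/10\<close> are
  small, so is the share of \<open>x2\<^sup>2 + y2\<^sup>2\<close>. Hence the radius, being at most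
  \<open>(1 - y1\<^sup>2)/16\<close>, is smaller than \<open>x1\<^sup>2/10\<close>, and \<open>x2 = X + x1\<^sup>2/10\<close> is positive.
\<close>

lemma third_positive:
  assumes "p \<in> S2" "(\<gamma> \<longlongrightarrow> p) at_top" "q \<in> S2" "(\<gamma> \<longlongrightarrow> q) at_bot"
  shows "\<gamma> t $ 3 > 0"
proof -
  define x1 y x w X r where "x1 = \<gamma> t $ 1" and "y = \<gamma> t $ 2" and "x = \<gamma> t $ 3" and "w = \<gamma> t $ 4"
    and "X = shifted t" and "r = sqrt (X\<^sup>2 + w\<^sup>2)"
  define k where "k = x1\<^sup>2 / 10"
  have sphere: "x1\<^sup>2 + y\<^sup>2 + x\<^sup>2 + w\<^sup>2 = 1"
    using on_S3[of t] by (simp add: S3_iff x1_def y_def x_def w_def)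
  have x: "x = X + k"
    by (simp add: X_def k_def x_def x1_def shifted_def)
  have r: "r \<le> (1 - y\<^sup>2) / 16" "r \<ge> 0" "\<bar>X\<bar> \<le> r" "r\<^sup>2 = X\<^sup>2 + w\<^sup>2"
    using radius_bound[OF assms, of t] by (auto simp: r_def X_def y_def w_def)
  have k: "0 < k" "k \<le> 1 / 10"
    using first_nonzero[of t] sphere by (auto simp: k_def x1_def, smt (verit) zero_le_power2)
  have "1 - y\<^sup>2 = 10 * k + r\<^sup>2 + 2 * X * k + k\<^sup>2"
    using sphere x r(4) by (simp add: k_def power2_eq_square algebra_simps)
  moreover have "r \<le> 1 / 16"
    using r(1) by (smt (verit) zero_le_power2 divide_right_mono)
  then have "r\<^sup>2 \<le> r / 16" "2 * X * k \<le> k / 8"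
    using r(2,3) k mult_right_mono[of r "1/16" r] mult_right_mono[of X "1/16" k] by (auto simp: power2_eq_square)
  moreover have "k\<^sup>2 \<le> k / 10"
    using k mult_right_mono[of k "1/10" k] by (auto simp: power2_eq_square)
  ultimately have "r < k"
    using r(1) k(1) by argo
  then show ?thesis
    using x r(3) by (simp add: x_def)
qed

lemma not_singular:
  assumes p: "p \<in> S2" "(\<gamma> \<longlongrightarrow> p) at_top" and q: "q \<in> S2" "(\<gamma> \<longlongrightarrow> q) at_bot"
  shows False
proof -
  have "\<exists>d. ((\<lambda>t. \<gamma> t $ 4) has_real_derivative d) (at t) \<and> 0 < d" for t
    using w_derivative third_positive[OF p q] scale_pos[OF on_S3] by (intro exI conjI) auto
  then have sm: "strict_mono (\<lambda>t. \<gamma> t $ 4)"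
    using DERIV_pos_imp_increasing by (intro strict_monoI) blast
  have "(\<lambda>t. \<gamma> t $ 4) 1 \<le> p $ 4"
    using strict_mono_mono[OF sm] tendsto_vec_nth[OF p(2)] by (rule mono_limit_at_top)
  moreover have "q $ 4 \<le> (\<lambda>t. \<gamma> t $ 4) 0"
    using strict_mono_mono[OF sm] tendsto_vec_nth[OF q(2)] by (rule mono_limit_at_bot)
  moreover have "\<gamma> 0 $ 4 < \<gamma> 1 $ 4"
    using strict_monoD[OF sm, of 0 1] by simp
  ultimately show False
    using limit_is_zero_of_reeb[OF _ p(2,1)] limit_is_zero_of_reeb[OF _ q(2,1)] by auto
qed

end

theorem theorem1:
  shows "\<exists>\<alpha> R. b_contact_form3 S3 S2 \<alpha> \<and> reeb_b_vector_field S3 S2 \<alpha> R \<and>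
    (\<nexists>\<gamma>. singular_periodic_orbit S3 S2 R \<gamma>) \<and>
    (\<nexists>\<gamma>. periodic_orbit_outside S3 S2 R \<gamma>)"
proof (intro exI conjI)
  show "\<nexists>\<gamma>. singular_periodic_orbit S3 S2 reeb \<gamma>"
    unfolding singular_periodic_orbit_def
    using outside_orbit.not_singular outside_orbit.intro by blast
  show "\<nexists>\<gamma>. periodic_orbit_outside S3 S2 reeb \<gamma>"
    unfolding periodic_orbit_outside_def
    using outside_orbit.not_periodic outside_orbit.intro by blast
qed (rule b_contact_alpha reeb_is_reeb_field)+

end
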